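(* Let $k\geq 3$ be a fixed integer and let $P_{\boldsymbol{\alpha}}(X)=\alpha_{k}X^{k}+\alpha_{k-1}X^{k-1}+\dots+\alpha_{1}X\in\mathbb{R}[X]$ be a fixed polynomial of degree $k$. Let $x>1$ be a sufficiently large real number and for $a\in\mathbb{N}$ put $S_{a}(\boldsymbol{\alpha}):=\sum_{m\leq x}\mathrm{e}(aP_{\boldsymbol{\alpha}}(m))$, the sum being over positive integers $m\le x$. Let $T>1$ be real and $z\in\mathbb{N}$ fixed. Let $s_{0}=(k-1)(k-2)/2+1$ and let $u,q$ be integers with $q\geq 1$, $(u,q)=1$ and $|\alpha_{k}-u/q|<q^{-2}$. Then for every $\varepsilon>0$, \[ \sum_{a\leq T}|S_{az}(\boldsymbol{\alpha})|\ll Tx\Big(\frac{zx^{k-1}}{q}+\frac{zx^{k-1}\log(q)}{T}+\frac{1}{x}+\frac{q\log(q)}{Tx}\Big)^{1/2s_{0}}x^{\varepsilon}, \] where the sum is over positive integers $a\le T$ and the implicit constant depends only on $k$ and $\varepsilon$.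
   Context: $\mathrm{e}(\alpha):=\exp(2\pi i\alpha)$ for real $\alpha$. *)

theory Defs
  imports Complex_Main "HOL-Computational_Algebra.Polynomial"
begin

definition e_real :: "real \<Rightarrow> complex" where
  "e_real \<alpha> = exp (2 * complex_of_real pi * \<i> * complex_of_real \<alpha>)"

definition weyl_sum :: "real poly \<Rightarrow> real \<Rightarrow> nat \<Rightarrow> complex" where
  "weyl_sum P x a = (\<Sum>m\<in>{1..nat \<lfloor>x\<rfloor>}. e_real (real a * poly P (real m)))"

(* The division is exact, since (k - 1) * (k - 2) is even. *)
definition s0 :: "nat \<Rightarrow> nat" where
  "s0 k = (k - 1) * (k - 2) div 2 + 1"

end

theory Submission
  imports Defs "HOL-Computational_Algebra.Primes" "HOL-Analysis.Convex"
begin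

text \<open>By Cauchy--Schwarz and a Fejer kernel, the sum over \<open>a \<le> T\<close> is controlled by the number of pairs
  \<open>(n + h, n)\<close> for which \<open>z (P (n + h) - P n)\<close> lies within \<open>1 / T\<close> of an integer. For fixed \<open>h\<close> this is a
  polynomial in \<open>n\<close> of degree \<open>k - 1\<close> with leading coefficient \<open>k h z \<alpha>\<close>, where \<open>\<alpha>\<close> is the leading
  coefficient of \<open>P\<close>. If \<open>k\<close> such \<open>n\<close> lie in a common block of length \<open>L\<close>, then divided differences show
  that \<open>V h k z \<alpha>\<close> is within \<open>k L ^ (s0 k - 1) / T\<close> of an integer, where \<open>V\<close> is the Vandermonde
  determinant of these \<open>n\<close>. The multiples of \<open>k z \<alpha>\<close> by integers up to \<open>q / (2 k z)\<close> are \<open>1 / (2 q)\<close>-spaced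
  modulo 1, so few integers \<open>W = V h\<close> are possible, and by the divisor bound each of them comes from
  few tuples for every value of the least \<open>n\<close>. Choosing \<open>L\<close> of size \<open>\<delta> powr (- 1 / s0 k)\<close>, with \<open>\<delta>\<close> the
  expression in parentheses in the theorem, bounds the number of pairs by \<open>x\<^sup>2 \<delta> powr (1 / s0 k)\<close> up to
  a factor \<open>x powr \<epsilon>\<close>. No mean value theorem of Vinogradov type is needed.\<close>

section \<open>The divisor bound\<close>

text \<open>\<open>exp y \<ge> 1 + y\<close> at \<open>y = k * e * ln 2\<close>. The constant
  depends on \<open>e\<close> alone; it is the price of one small prime in the divisor
  bound.\<close>

lemma Suc_le_powr_two:
  assumes "e > 0"
  shows "real (k + 1) \<le> max 1 (1 / (e * ln 2)) * 2 powr (real k * e)"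
proof -
  have "1 + real k * e * ln 2 \<le> exp (real k * e * ln 2)"
    by (rule exp_ge_add_one_self)
  also have "\<dots> = 2 powr (real k * e)"
    by (simp add: powr_def)
  finally have *: "1 + real k * e * ln 2 \<le> 2 powr (real k * e)" .
  have "real (k + 1) = 1 + 1 / (e * ln 2) * (real k * e * ln 2)"
    using assms by simp
  also have "\<dots> \<le> max 1 (1 / (e * ln 2)) * 1 + max 1 (1 / (e * ln 2)) * (real k * e * ln 2)"
    using assms by (intro add_mono mult_right_mono) auto
  also have "\<dots> = max 1 (1 / (e * ln 2)) * (1 + real k * e * ln 2)"
    by (simp only: ring_distribs)
  also have "\<dots> \<le> max 1 (1 / (e * ln 2)) * 2 powr (real k * e)"
    using * by (intro mult_left_mono) auto
  finally show ?thesis .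
qed

lemma card_divisors_primepow_mult_le:
  fixes p n :: nat
  assumes "prime p" "n > 0"
  shows "card {d. d dvd p ^ k * n} \<le> (k + 1) * card {d. d dvd n}"
proof -
  have "{d. d dvd p ^ k * n} \<subseteq> (\<lambda>(i, d). p ^ i * d) ` ({..k} \<times> {d. d dvd n})"
  proof
    fix d assume "d \<in> {d. d dvd p ^ k * n}"
    then obtain a b where ab: "d = a * b" "a dvd p ^ k" "b dvd n"
      using division_decomp by blast
    then obtain i where "i \<le> k" "a = p ^ i"
      using divides_primepow_nat[OF assms(1)] by auto
    then show "d \<in> (\<lambda>(i, d). p ^ i * d) ` ({..k} \<times> {d. d dvd n})"
      using ab by auto
  qed
  then have "card {d. d dvd p ^ k * n} \<le> card ({..k} \<times> {d. d dvd n})"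
    using assms(2) by (intro surj_card_le) auto
  then show ?thesis
    by (simp add: card_cartesian_product)
qed

text \<open>Strip off one prime power \<open>p ^ k\<close> at a time. If
  \<open>p powr e \<ge> 2\<close>, then \<open>k + 1 \<le> 2 ^ k\<close> is at most
  \<open>p powr (k * e)\<close>, so such primes are free; the others lie below \<open>B\<close>, and
  each costs one factor \<open>D\<close>.\<close>

lemma card_divisors_le_powr:
  fixes e :: real
  assumes "e > 0"
  obtains C where "C \<ge> 1" "\<And>n::nat. n > 0 \<Longrightarrow> real (card {d. d dvd n}) \<le> C * real n powr e"
proof -
  define D where "D = max 1 (1 / (e * ln 2))"
  define B where "B = nat \<lceil>2 powr (1 / e)\<rceil>"
  define Q where "Q n = {p. prime p \<and> p dvd n \<and> p < B}" for n :: nat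
  have finQ: "finite (Q n)" for n
    unfolding Q_def by (rule finite_subset[of _ "{..<B}"]) auto
  have D: "D \<ge> 1"
    by (simp add: D_def)
  have main: "real (card {d. d dvd n}) \<le> D ^ card (Q n) * real n powr e" if "n > 0" for n
    using that
  proof (induction n rule: less_induct)
    case (less n)
    show ?case
    proof (cases "n = 1")
      case True
      then show ?thesis using D by (simp add: one_le_power)
    next
      case False
      with less.prems obtain p k m
        where p: "prime p" "p dvd n" and m: "n = p ^ k * m" "\<not> p dvd m" and "k > 0"
        by (metis divide_out_primepow nat_dvd_1_iff_1 neq0_conv)
      have mpos: "m > 0" using m less.prems by (intro Nat.gr0I) auto
      have "p ^ k > 1"
        using \<open>k > 0\<close> prime_gt_1_nat[OF p(1)] one_less_power by blast
      then have mn: "m < n"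
        using mpos m(1) by simp
      \<comment> \<open>The inequality between the cardinalities accompanies the estimate because
        the exponent of \<open>D\<close> is a truncated difference, which has to recombine with
        \<open>card (Q m)\<close> to \<open>card (Q n)\<close>.\<close>
      have step: "real (k + 1) \<le> D ^ (card (Q n) - card (Q m)) * (real p powr (real k * e))
                   \<and> card (Q m) \<le> card (Q n)"
      proof (cases "p < B")
        case True
        have "insert p (Q m) \<subseteq> Q n"
          using True p m(1) by (auto simp: Q_def)
        moreover have "p \<notin> Q m"
          using m(2) by (simp add: Q_def)
        ultimately have less: "card (Q m) + 1 \<le> card (Q n)"
          using card_mono[OF finQ, of "insert p (Q m)" n] finQ by simp
        have "real (k + 1) \<le> D * 2 powr (real k * e)"
          using Suc_le_powr_two[OF assms] by (simp add: D_def)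
        also have "\<dots> \<le> D ^ (card (Q n) - card (Q m)) * (real p powr (real k * e))"
        proof (intro mult_mono powr_mono2)
          show "D \<le> D ^ (card (Q n) - card (Q m))"
            using D less by (intro self_le_power) auto
        qed (use D assms prime_ge_2_nat[OF p(1)] in auto)
        finally show ?thesis using less by simp
      next
        case False
        have "Q m \<subseteq> Q n"
          using m(1) by (auto simp: Q_def)
        then have le: "card (Q m) \<le> card (Q n)"
          using finQ by (intro card_mono)
        have "2 powr (1 / e) \<le> real p"
          using False real_nat_ceiling_ge[of "2 powr (1 / e)"] unfolding B_def
          by (meson leI of_nat_mono order_trans)
        then have "(2 powr (1 / e)) powr (real k * e) \<le> real p powr (real k * e)"
          using assms by (intro powr_mono2) auto
        moreover have "(2 powr (1 / e)) powr (real k * e) = 2 ^ k"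
          using assms by (simp add: powr_powr powr_realpow)
        moreover have "real (k + 1) \<le> 2 ^ k"
          using of_nat_mono[OF Suc_leI[OF less_exp[of k]], where ?'a = real] by simp
        ultimately have "real (k + 1) \<le> 1 * real p powr (real k * e)"
          by simp
        also have "\<dots> \<le> D ^ (card (Q n) - card (Q m)) * (real p powr (real k * e))"
          using D by (intro mult_right_mono one_le_power) auto
        finally show ?thesis using le by simp
      qed
      have "real (card {d. d dvd n}) \<le> real ((k + 1) * card {d. d dvd m})"
        unfolding m(1) using card_divisors_primepow_mult_le[OF p(1) mpos] by (rule of_nat_mono)
      also have "\<dots> \<le> (D ^ (card (Q n) - card (Q m)) * real p powr (real k * e))
                       * (D ^ card (Q m) * real m powr e)"
        unfolding of_nat_mult using step less.IH[OF mn mpos] D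
        by (intro mult_mono) auto
      also have "\<dots> = D ^ card (Q n) * (real p powr (real k * e) * real m powr e)"
      proof -
        have "D ^ (card (Q n) - card (Q m)) * D ^ card (Q m) = D ^ card (Q n)"
          using step by (simp flip: power_add)
        then show ?thesis
          by (simp only: mult_ac)
      qed
      also have "real p powr (real k * e) * real m powr e = real n powr e"
        using prime_gt_0_nat[OF p(1)] unfolding m(1)
        by (simp add: powr_mult powr_powr flip: powr_realpow)
      finally show ?thesis .
    qed
  qed
  show thesis
  proof (rule that[of "D ^ B"])
    show "D ^ B \<ge> 1" using D by (rule one_le_power)
    fix n :: nat assume n: "n > 0"
    have "card (Q n) \<le> card {..<B}"
      by (intro card_mono) (auto simp: Q_def)
    then have "D ^ card (Q n) \<le> D ^ B"
      using D by (intro power_increasing) auto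
    then show "real (card {d. d dvd n}) \<le> D ^ B * real n powr e"
      using main[OF n] by (meson mult_right_mono order_trans powr_ge_zero)
  qed
qed

section \<open>Divided differences and Vandermonde determinants\<close>

text \<open>Two terms of the binomial theorem, by induction along the Horner form. At
  \<open>n = degree p\<close> it leaves the leading coefficient unchanged; one below, it gives the
  term linear in \<open>h\<close>.\<close>

lemma coeff_pcompose_shift:
  fixes p :: "'a :: comm_semiring_1 poly"
  assumes "degree p \<le> Suc n"
  shows "coeff (p \<circ>\<^sub>p [:h, 1:]) n = coeff p n + of_nat (Suc n) * h * coeff p (Suc n)"
  using assms
proof (induction p arbitrary: n)
  case 0
  then show ?case by simp
next
  case (pCons a p)
  show ?case
  proof (cases n)
    case 0
    then have "degree p = 0"
      using pCons.prems by (auto split: if_splits)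
    then obtain b where "p = [:b:]"
      by (rule degree_eq_zeroE)
    then show ?thesis
      using 0 by (simp add: pcompose_pCons algebra_simps)
  next
    case (Suc m)
    have deg: "degree p \<le> Suc m"
      using pCons.prems Suc by (auto split: if_splits)
    have "coeff (p \<circ>\<^sub>p [:h, 1:]) m = coeff p m + of_nat (Suc m) * h * coeff p (Suc m)"
      using pCons.IH[OF deg] .
    moreover have "coeff (p \<circ>\<^sub>p [:h, 1:]) (Suc m) = coeff p (Suc m)"
      using pCons.IH[of "Suc m"] deg by (simp add: coeff_eq_0)
    ultimately show ?thesis
      using Suc by (simp add: pcompose_pCons algebra_simps)
  qed
qed

text \<open>Lagrange interpolation: with more nodes than its degree, \<open>f\<close> equals its
  interpolant \<open>Q\<close>. Each \<open>B s\<close> is monic of degree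
  \<open>card S - 1\<close>, so the top coefficient of \<open>Q\<close> is the sum of the
  weights.\<close>

lemma coeff_eq_divided_difference:
  fixes f :: "real poly" and S :: "nat set"
  assumes "finite S" "degree f < card S"
  shows "coeff f (card S - 1) = (\<Sum>s\<in>S. poly f (real s) / (\<Prod>t\<in>S - {s}. real s - real t))"
proof -
  define B where "B s = (\<Prod>t\<in>S - {s}. [:- real t, 1:])" for s
  define Q where "Q = (\<Sum>s\<in>S. smult (poly f (real s) / (\<Prod>t\<in>S - {s}. real s - real t)) (B s))"
  have degB: "degree (B s) = card S - 1" if "s \<in> S" for s
    using that assms(1) by (simp add: B_def degree_prod_eq_sum_degree)
  have lcB: "coeff (B s) (card S - 1) = 1" if "s \<in> S" for s
  proof -
    have "lead_coeff (B s) = 1"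
      by (simp add: B_def lead_coeff_prod)
    then show ?thesis
      using degB[OF that] by simp
  qed
  have "f = Q"
  proof (rule poly_eqI_degree[where A = "real ` S"])
    have card: "card (real ` S) = card S"
      by (intro card_image) (simp add: inj_on_def)
    then show "degree f < card (real ` S)"
      using assms(2) by simp
    have "degree Q \<le> card S - 1"
      unfolding Q_def using degB by (intro degree_sum_le[OF assms(1)] order_trans[OF degree_smult_le]) simp
    then show "degree Q < card (real ` S)"
      using card assms(2) by linarith
    fix x assume "x \<in> real ` S"
    then obtain r where r: "r \<in> S" "x = real r"
      by blast
    have "poly (B s) (real r) = (if s = r then \<Prod>t\<in>S - {r}. real r - real t else 0)"
      if "s \<in> S" for s
      using that r assms(1) by (auto simp: B_def poly_prod algebra_simps)
    then have "poly Q x = (\<Sum>s\<in>S. if s = r then poly f (real r) / (\<Prod>t\<in>S - {r}. real r - real t)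
                 * (\<Prod>t\<in>S - {r}. real r - real t) else 0)"
      unfolding Q_def r(2) poly_sum poly_smult by (intro sum.cong) auto
    also have "\<dots> = poly f (real r)"
      using assms(1) r(1) by simp
    finally show "poly f x = poly Q x"
      by (simp add: r)
  qed
  then have "coeff f (card S - 1) = coeff Q (card S - 1)"
    by simp
  also have "\<dots> = (\<Sum>s\<in>S. poly f (real s) / (\<Prod>t\<in>S - {s}. real s - real t))"
    unfolding Q_def coeff_sum by (intro sum.cong) (simp_all add: lcB[unfolded One_nat_def])
  finally show ?thesis .
qed

text \<open>The absolute value of the Vandermonde determinant of \<open>S\<close>; only pairs with
  \<open>a < b\<close> occur, so the subtraction is exact.\<close>

definition vandermonde :: "nat set \<Rightarrow> nat" where
  "vandermonde S = (\<Prod>a\<in>S. \<Prod>b | b \<in> S \<and> a < b. b - a)"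

text \<open>With truncated subtraction, \<open>(s - t) + (t - s)\<close> is the distance of \<open>s\<close> and \<open>t\<close>.\<close>

lemma vandermonde_insert:
  assumes "finite S" "s \<notin> S"
  shows "vandermonde (insert s S) = vandermonde S * (\<Prod>t\<in>S. (s - t) + (t - s))"
proof -
  have 1: "{b. b \<in> insert s S \<and> s < b} = {b \<in> S. s < b}"
    by auto
  have 2: "(\<Prod>b | b \<in> insert s S \<and> a < b. b - a)
      = (\<Prod>b | b \<in> S \<and> a < b. b - a) * (if a < s then s - a else 1)" if "a \<in> S" for a
  proof (cases "a < s")
    case True
    then have "{b. b \<in> insert s S \<and> a < b} = insert s {b \<in> S. a < b}"
      by auto
    then show ?thesis
      using True assms by (simp add: mult.commute)
  next
    case False
    then have "{b. b \<in> insert s S \<and> a < b} = {b \<in> S. a < b}"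
      by auto
    then show ?thesis
      using False by simp
  qed
  have 3: "(\<Prod>b | b \<in> S \<and> s < b. b - s) = (\<Prod>b\<in>S. if s < b then b - s else 1)"
    using assms(1) by (simp add: prod.inter_filter)
  have "vandermonde (insert s S)
      = (\<Prod>b\<in>S. if s < b then b - s else 1)
        * ((\<Prod>a\<in>S. \<Prod>b | b \<in> S \<and> a < b. b - a) * (\<Prod>a\<in>S. if a < s then s - a else 1))"
    unfolding vandermonde_def using assms by (simp add: 1 2 3 prod.distrib del: insert_iff cong: prod.cong)
  also have "\<dots> = vandermonde S * (\<Prod>b\<in>S. (if s < b then b - s else 1) * (if b < s then s - b else 1))"
    by (simp add: vandermonde_def prod.distrib mult_ac)
  also have "(\<Prod>b\<in>S. (if s < b then b - s else 1) * (if b < s then s - b else 1))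
      = (\<Prod>t\<in>S. (s - t) + (t - s))"
    using assms(2) by (intro prod.cong) auto
  finally show ?thesis .
qed

lemma vandermonde_pos: "finite S \<Longrightarrow> vandermonde S > 0"
  by (simp add: vandermonde_def prod_pos)

lemma diff_dvd_vandermonde:
  assumes "finite S" "a \<in> S" "b \<in> S" "a < b"
  shows "b - a dvd vandermonde S"
proof -
  have "b - a dvd (\<Prod>b | b \<in> S \<and> a < b. b - a)"
    using assms by (intro dvd_prodI) auto
  also have "\<dots> dvd vandermonde S"
    unfolding vandermonde_def using assms by (intro dvd_prodI[of S a]) auto
  finally show ?thesis .
qed

text \<open>One factor for each pair of elements; inserting \<open>s\<close> adds
  \<open>card S\<close> factors, each a distance from \<open>s\<close>.\<close>

lemma vandermonde_le:
  assumes "finite S" "\<And>s t. s \<in> S \<Longrightarrow> t \<in> S \<Longrightarrow> s - t \<le> L"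
  shows "vandermonde S \<le> L ^ (card S * (card S - 1) div 2)"
  using assms
proof (induction S)
  case empty
  then show ?case by (simp add: vandermonde_def)
next
  case (insert s S)
  have "(\<Prod>t\<in>S. (s - t) + (t - s)) \<le> (\<Prod>t\<in>S. L)"
  proof (intro prod_mono conjI)
    fix t assume "t \<in> S"
    then show "(s - t) + (t - s) \<le> L"
      using insert.prems[of s t] insert.prems[of t s] by (cases "s < t") auto
  qed auto
  then have "vandermonde (insert s S) \<le> L ^ (card S * (card S - 1) div 2) * L ^ card S"
    using insert by (simp add: vandermonde_insert mult_le_mono)
  also have "\<dots> = L ^ (card S * (card S - 1) div 2 + card S)"
    by (simp add: power_add)
  also have "card S * (card S - 1) div 2 + card S = card (insert s S) * (card (insert s S) - 1) div 2"
  proof -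
    have "card S * (card S - 1) + 2 * card S = (card S + 1) * card S"
      by (cases "card S") (auto simp: algebra_simps)
    moreover have "(card S * (card S - 1) + 2 * card S) div 2 = card S * (card S - 1) div 2 + card S"
      by (simp only: div_mult_self2[OF zero_neq_numeral[symmetric]] add.commute)
    ultimately show ?thesis
      using insert.hyps by simp
  qed
  finally show ?case .
qed

text \<open>Multiplying the divided difference by the Vandermonde determinant leaves the Vandermonde
  determinants of the subsets \<open>S - {s}\<close>, up to sign, as integer coefficients.\<close>

lemma vandermonde_mult_coeff_near_int:
  fixes f :: "real poly"
  assumes "finite S" "degree f < card S" "\<eta> \<ge> 0"
    and diam: "\<And>s t. s \<in> S \<Longrightarrow> t \<in> S \<Longrightarrow> s - t \<le> L"
    and near: "\<And>s. s \<in> S \<Longrightarrow> \<exists>j::int. \<bar>poly f (real s) - real_of_int j\<bar> \<le> \<eta>"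
  shows "\<exists>j::int. \<bar>real (vandermonde S) * coeff f (card S - 1) - real_of_int j\<bar>
           \<le> real (card S) * real L ^ ((card S - 1) * (card S - 2) div 2) * \<eta>"
proof -
  obtain i :: "nat \<Rightarrow> int" where i: "\<And>s. s \<in> S \<Longrightarrow> \<bar>poly f (real s) - real_of_int (i s)\<bar> \<le> \<eta>"
    using near by metis
  define c :: "nat \<Rightarrow> int"
    where "c s = int (vandermonde (S - {s})) * (\<Prod>t\<in>S - {s}. sgn (int s - int t))" for s
  have c_bound: "\<bar>real_of_int (c s)\<bar> \<le> real L ^ ((card S - 1) * (card S - 2) div 2)"
    if "s \<in> S" for s
  proof -
    have "\<bar>real_of_int (c s)\<bar> = real (vandermonde (S - {s}))"
    proof -
      have "\<bar>real_of_int (sgn (int s - int t))\<bar> = 1" if "t \<in> S - {s}" for t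
        using that by (cases "t < s") (auto simp: sgn_if)
      then have "(\<Prod>t\<in>S - {s}. \<bar>real_of_int (sgn (int s - int t))\<bar>) = 1"
        by (rule prod.neutral[OF ballI])
      then show ?thesis
        by (simp add: c_def abs_mult abs_prod)
    qed
    also have "\<dots> \<le> real (L ^ (card (S - {s}) * (card (S - {s}) - 1) div 2))"
      using assms(1) diam by (intro of_nat_mono vandermonde_le) auto
    also have "\<dots> = real L ^ ((card S - 1) * (card S - 2) div 2)"
      using that assms(1) by (simp add: numeral_2_eq_2)
    finally show ?thesis .
  qed
  have c: "real (vandermonde S) / (\<Prod>t\<in>S - {s}. real s - real t) = real_of_int (c s)"
    if "s \<in> S" for s
  proof -
    have nz: "(\<Prod>t\<in>S - {s}. real s - real t) \<noteq> 0"
      using assms(1) by auto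
    have "vandermonde S = vandermonde (S - {s}) * (\<Prod>t\<in>S - {s}. (s - t) + (t - s))"
      using vandermonde_insert[of "S - {s}" s] assms(1) that by (simp add: insert_absorb)
    then have "real (vandermonde S)
        = real (vandermonde (S - {s})) * (\<Prod>t\<in>S - {s}. real ((s - t) + (t - s)))"
      by simp
    also have "(\<Prod>t\<in>S - {s}. real ((s - t) + (t - s)))
        = (\<Prod>t\<in>S - {s}. real_of_int (sgn (int s - int t)) * (real s - real t))"
      by (intro prod.cong) (auto simp: sgn_if of_nat_diff)
    finally show ?thesis
      using nz by (simp add: c_def prod.distrib)
  qed
  have "real (vandermonde S) * coeff f (card S - 1)
      = (\<Sum>s\<in>S. (real (vandermonde S) / (\<Prod>t\<in>S - {s}. real s - real t)) * poly f (real s))"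
    unfolding coeff_eq_divided_difference[OF assms(1,2)] sum_distrib_left by (intro sum.cong) auto
  also have "\<dots> = (\<Sum>s\<in>S. real_of_int (c s) * poly f (real s))"
    using c by (intro sum.cong) auto
  \<comment> \<open>Replacing each value by its nearby integer \<open>i s\<close> leaves an integer
    and an error of at most \<open>\<eta>\<close> times the sum of the
    \<open>\<bar>c s\<bar>\<close>.\<close>
  finally have eq: "real (vandermonde S) * coeff f (card S - 1) - real_of_int (\<Sum>s\<in>S. c s * i s)
      = (\<Sum>s\<in>S. real_of_int (c s) * (poly f (real s) - real_of_int (i s)))"
    by (simp add: sum_subtractf right_diff_distrib)
  have "\<bar>\<Sum>s\<in>S. real_of_int (c s) * (poly f (real s) - real_of_int (i s))\<bar>
      \<le> (\<Sum>s\<in>S. real L ^ ((card S - 1) * (card S - 2) div 2) * \<eta>)"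
    using c_bound i
    by (intro order_trans[OF sum_abs] sum_mono) (simp add: abs_mult mult_mono)
  also have "\<dots> = real (card S) * real L ^ ((card S - 1) * (card S - 2) div 2) * \<eta>"
    by simp
  finally show ?thesis
    unfolding eq[symmetric] by blast
qed

section \<open>Mean squares of exponential sums\<close>

lemma e_real_add: "e_real (x + y) = e_real x * e_real y"
  by (simp add: e_real_def algebra_simps flip: exp_add)

lemma e_real_eq_cis: "e_real x = cis (2 * pi * x)"
  by (simp add: e_real_def cis_conv_exp mult_ac)

lemma norm_e_real [simp]: "cmod (e_real x) = 1"
  by (simp add: e_real_eq_cis)

lemma cnj_e_real: "cnj (e_real x) = e_real (- x)"
  by (simp add: e_real_eq_cis cis_cnj)

lemma e_real_of_int [simp]: "e_real (real_of_int n) = 1"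
  by (simp add: e_real_eq_cis)

lemma e_real_of_nat_mult: "e_real (real n * x) = e_real x ^ n"
  by (simp add: e_real_eq_cis Complex.DeMoivre mult_ac)

lemma sin_pi_mult_ge:
  assumes "0 \<le> t" "t \<le> 1 / 2"
  shows "sin (pi * t) \<ge> t / 2"
proof -
  define y where "y = pi * t"
  \<comment> \<open>For \<open>y \<le> 2\<close> the cubic remainder \<open>y ^ 3 / 6\<close> is at
    most \<open>2 * y / 3\<close>, which leaves \<open>sin y \<ge> y / 3\<close>.\<close>
  have y: "0 \<le> y" "y \<le> 2"
    using assms pi_less_4 mult_mono[of pi 4 t "1/2"] by (auto simp: y_def)
  have "\<bar>sin y - (\<Sum>m<3. sin_coeff m * y ^ m)\<bar> \<le> inverse (fact 3) * \<bar>y\<bar> ^ 3"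
    by (rule Maclaurin_sin_bound)
  then have "\<bar>sin y - y\<bar> \<le> y ^ 3 / 6"
    using y by (simp add: eval_nat_numeral sin_coeff_def field_simps)
  moreover have "y ^ 3 \<le> 4 * y"
    using y mult_mono[of y 2 y 2] mult_right_mono[of "y * y" 4 y] by (simp add: eval_nat_numeral)
  ultimately have "sin y \<ge> y / 3"
    by linarith
  moreover have "y \<ge> 2 * t"
    unfolding y_def using assms pi_ge_two by (intro mult_right_mono) auto
  ultimately show ?thesis
    using assms unfolding y_def by linarith
qed

text \<open>The modulus is \<open>2 * \<bar>sin (pi * t)\<bar>\<close>, and reflection at
  \<open>1 / 2\<close> reduces to the range of \<open>sin_pi_mult_ge\<close>. The minimum is the
  distance from \<open>t\<close> to the nearest integer.\<close>

lemma norm_e_real_minus_1_ge: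
  assumes "\<bar>t\<bar> \<le> 1"
  shows "cmod (e_real t - 1) \<ge> min \<bar>t\<bar> (1 - \<bar>t\<bar>)"
proof -
  have "sin (pi * \<bar>t\<bar>) \<ge> min \<bar>t\<bar> (1 - \<bar>t\<bar>) / 2"
  proof (cases "\<bar>t\<bar> \<le> 1 / 2")
    case True
    then show ?thesis
      using sin_pi_mult_ge[of "\<bar>t\<bar>"] by simp
  next
    case False
    have "sin (pi * \<bar>t\<bar>) = sin (pi * (1 - \<bar>t\<bar>))"
      by (simp add: right_diff_distrib)
    then show ?thesis
      using sin_pi_mult_ge[of "1 - \<bar>t\<bar>"] assms False by simp
  qed
  moreover have "cmod (e_real t - 1) = 2 * \<bar>sin (pi * t)\<bar>"
  proof -
    have "e_real t - 1 = cis (pi * t) * (cis (pi * t) - cis (- (pi * t)))"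
      by (simp add: e_real_eq_cis right_diff_distrib cis_mult mult_ac flip: mult_2)
    also have "cis (pi * t) - cis (- (pi * t)) = 2 * \<i> * complex_of_real (sin (pi * t))"
      by (simp add: complex_eq_iff)
    finally show ?thesis
      by (simp add: norm_mult)
  qed
  moreover have "sin (pi * \<bar>t\<bar>) \<le> \<bar>sin (pi * t)\<bar>"
    by (cases "t \<ge> 0") auto
  ultimately show ?thesis
    by linarith
qed

text \<open>Telescoping against \<open>e_real t - 1\<close>. The product form covers integral
  \<open>t\<close>, where the distance vanishes.\<close>

lemma geometric_e_real_le:
  assumes "\<bar>t\<bar> \<le> 1"
  shows "cmod (\<Sum>b<A. e_real (real b * t)) * min \<bar>t\<bar> (1 - \<bar>t\<bar>) \<le> 2"
proof -
  have "(\<Sum>b<A. e_real (real b * t)) * (e_real t - 1) = e_real t ^ A - 1"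
    unfolding e_real_of_nat_mult by (metis mult.commute power_diff_1_eq)
  then have "cmod (\<Sum>b<A. e_real (real b * t)) * cmod (e_real t - 1) = cmod (e_real t ^ A - 1)"
    by (metis norm_mult)
  also have "\<dots> \<le> 2"
    using norm_triangle_ineq4[of "e_real t ^ A" 1] by (simp add: norm_power)
  finally show ?thesis
    using norm_e_real_minus_1_ge[OF assms] by (meson mult_left_mono norm_ge_zero order_trans)
qed

text \<open>A majorant of the squared geometric sum of length \<open>A\<close>, divided by
  \<open>A\<^sup>2\<close>, at distance about \<open>d / A\<close> from an integer. The
  \<open>- 1\<close> absorbs the rounding to cells of width \<open>1 / A\<close>; for
  \<open>d \<le> 1\<close> the weight is the trivial bound.\<close>

definition fejer_weight :: "nat \<Rightarrow> real" where
  "fejer_weight d = (if d \<le> 1 then 1 else 4 / (real d - 1)\<^sup>2)"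

lemma fejer_weight_nonneg: "fejer_weight d \<ge> 0"
  by (simp add: fejer_weight_def)

lemma sum_fejer_weight_le: "(\<Sum>d<n. fejer_weight d) \<le> 10"
proof -
  \<comment> \<open>The first three weights are 1, 1 and 4, so the start is
    \<open>6 = 10 - 4\<close>; the later ones telescope.\<close>
  have *: "(\<Sum>d<m + 3. fejer_weight d) \<le> 10 - 4 / (real m + 1)" for m
  proof (induction m)
    case 0
    then show ?case by (simp add: eval_nat_numeral fejer_weight_def)
  next
    case (Suc m)
    have "fejer_weight (m + 3) = 4 / (real m + 2)\<^sup>2"
      by (simp add: fejer_weight_def)
    also have "\<dots> \<le> 4 / ((real m + 1) * (real m + 2))"
      unfolding power2_eq_square by (intro divide_left_mono mult_right_mono) auto
    also have "\<dots> = 4 / (real m + 1) - 4 / (real m + 2)"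
      by (simp add: field_simps)
    finally have "fejer_weight (m + 3) \<le> 4 / (real m + 1) - 4 / (real m + 2)" .
    moreover have "(\<Sum>d<Suc m + 3. fejer_weight d) = (\<Sum>d<m + 3. fejer_weight d) + fejer_weight (m + 3)"
      by (simp only: add_Suc sum.lessThan_Suc)
    ultimately have "(\<Sum>d<Suc m + 3. fejer_weight d) \<le> 10 - 4 / (real m + 2)"
      using Suc by linarith
    also have "real m + 2 = real (Suc m) + 1"
      by simp
    finally show ?case .
  qed
  have "(\<Sum>d<n. fejer_weight d) \<le> (\<Sum>d<n + 3. fejer_weight d)"
    by (intro sum_mono2) (auto simp: fejer_weight_nonneg)
  then show ?thesis
    using *[of n] by (smt (verit) divide_nonneg_nonneg of_nat_0_le_iff)
qed

text \<open>Up to rounding, \<open>\<bar>t\<bar>\<close> is \<open>d / A\<close> and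
  \<open>1 - \<bar>t\<bar>\<close> is \<open>(A - d) / A\<close>. The smaller one governs the
  geometric sum; adding both weights avoids the distinction.\<close>

lemma fejer_kernel_le:
  assumes "\<bar>t\<bar> < 1" "\<bar>real A * t - (real c - real c')\<bar> < 1" "c < A" "c' < A"
  defines "d \<equiv> (c - c') + (c' - c)"
  shows "(cmod (\<Sum>b<A. e_real (real b * t)))\<^sup>2 \<le> (real A)\<^sup>2 * (fejer_weight d + fejer_weight (A - d))"
proof (cases "d \<le> 1 \<or> A - d \<le> 1")
  case True
  \<comment> \<open>Equal cells, or cells that touch, possibly around the circle: one of the weights
    is 1, so the trivial bound is enough.\<close>
  have "cmod (\<Sum>b<A. e_real (real b * t)) \<le> real A"
    using norm_sum[of "\<lambda>b. e_real (real b * t)" "{..<A}"] by simp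
  then have "(cmod (\<Sum>b<A. e_real (real b * t)))\<^sup>2 \<le> (real A)\<^sup>2 * 1"
    by (simp add: power_mono)
  also have "\<dots> \<le> (real A)\<^sup>2 * (fejer_weight d + fejer_weight (A - d))"
  proof (intro mult_left_mono)
    show "1 \<le> fejer_weight d + fejer_weight (A - d)"
      using True fejer_weight_nonneg[of d] fejer_weight_nonneg[of "A - d"]
      by (auto simp: fejer_weight_def[of d] fejer_weight_def[of "A - d"] split: if_splits)
  qed auto
  finally show ?thesis .
next
  case False
  have A: "real A > 0" and dA: "d < A"
    using assms(3,4) by (auto simp: d_def)
  have d: "real d = \<bar>real c - real c'\<bar>"
    by (cases "c < c'") (auto simp: d_def of_nat_diff)
  have "\<bar>real A * t\<bar> \<ge> real d - 1" "\<bar>real A * t\<bar> \<le> real d + 1"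
    using assms(2) d by linarith+
  then have t: "\<bar>t\<bar> \<ge> (real d - 1) / real A" "1 - \<bar>t\<bar> \<ge> (real (A - d) - 1) / real A"
    using A dA by (auto simp: field_simps abs_mult)
  have sq: "(cmod (\<Sum>b<A. e_real (real b * t)))\<^sup>2 \<le> (real A)\<^sup>2 * fejer_weight e"
    if "e \<ge> 2" "(real e - 1) / real A \<le> min \<bar>t\<bar> (1 - \<bar>t\<bar>)" for e
  proof -
    have e: "real e - 1 > 0"
      using that(1) by simp
    have "cmod (\<Sum>b<A. e_real (real b * t)) * ((real e - 1) / real A) \<le> 2"
      using geometric_e_real_le[of t A] assms(1) that(2)
      by (meson less_imp_le mult_left_mono norm_ge_zero order_trans)
    then have "cmod (\<Sum>b<A. e_real (real b * t)) \<le> 2 * real A / (real e - 1)"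
      using A e by (simp add: field_simps)
    then have "(cmod (\<Sum>b<A. e_real (real b * t)))\<^sup>2 \<le> (2 * real A / (real e - 1))\<^sup>2"
      by (intro power_mono) auto
    also have "\<dots> = (real A)\<^sup>2 * fejer_weight e"
      using that(1) by (simp add: fejer_weight_def power_divide power_mult_distrib)
    finally show ?thesis .
  qed
  have "(cmod (\<Sum>b<A. e_real (real b * t)))\<^sup>2 \<le> (real A)\<^sup>2 * fejer_weight d
      \<or> (cmod (\<Sum>b<A. e_real (real b * t)))\<^sup>2 \<le> (real A)\<^sup>2 * fejer_weight (A - d)"
  proof (cases "\<bar>t\<bar> \<le> 1 - \<bar>t\<bar>")
    case True
    then show ?thesis using sq[of d] False t by auto
  next
    case 2: False
    then show ?thesis using sq[of "A - d"] False t by auto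
  qed
  then show ?thesis
    using fejer_weight_nonneg[of d] fejer_weight_nonneg[of "A - d"]
    by (smt (verit) distrib_left mult_nonneg_nonneg zero_le_power2)
qed

lemma sum_abs_diff_le:
  fixes F :: "nat \<Rightarrow> real"
  assumes "\<And>d. F d \<ge> 0" "c < A"
  shows "(\<Sum>c'<A. F ((c - c') + (c' - c))) \<le> 2 * (\<Sum>d<A. F d)"
proof -
  have "(\<Sum>c'<A. F ((c - c') + (c' - c))) = (\<Sum>c'\<in>{..<c} \<union> {c..<A}. F ((c - c') + (c' - c)))"
    using assms(2) by (intro sum.cong) auto
  also have "\<dots> = (\<Sum>c'<c. F (c - c')) + (\<Sum>c'=c..<A. F (c' - c))"
    by (subst sum.union_disjoint) auto
  also have "(\<Sum>c'<c. F (c - c')) = (\<Sum>d\<in>(\<lambda>c'. c - c') ` {..<c}. F d)"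
    by (subst sum.reindex) (auto simp: inj_on_def)
  also have "\<dots> \<le> (\<Sum>d<A. F d)"
    using assms by (intro sum_mono2) auto
  also have "(\<Sum>c'=c..<A. F (c' - c)) = (\<Sum>d\<in>(\<lambda>c'. c' - c) ` {c..<A}. F d)"
    by (subst sum.reindex) (auto simp: inj_on_def)
  also have "\<dots> \<le> (\<Sum>d<A. F d)"
    using assms by (intro sum_mono2) auto
  finally show ?thesis by simp
qed

section \<open>Duality and counting by cells\<close>

lemma sum_cells:
  fixes F :: "'b \<Rightarrow> real"
  assumes "finite M" "finite T" "\<And>m. m \<in> M \<Longrightarrow> g m \<in> T"
  shows "(\<Sum>m\<in>M. F (g m)) = (\<Sum>c\<in>T. real (card {m \<in> M. g m = c}) * F c)"
proof -
  have "(\<Sum>m\<in>M. F (g m)) = (\<Sum>c\<in>T. \<Sum>m\<in>{m \<in> M. g m = c}. F (g m))"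
    using assms by (intro sum.group[symmetric]) auto
  also have "\<dots> = (\<Sum>c\<in>T. \<Sum>m\<in>{m \<in> M. g m = c}. F c)"
    by (intro sum.cong) auto
  finally show ?thesis
    by simp
qed

text \<open>Expanding the squares gives the same fourfold sum on both sides. In the application a
  mean square over frequencies becomes a sum over pairs \<open>(m, n)\<close> of squared geometric
  sums.\<close>

lemma dual_square_sum:
  fixes w :: "'b \<Rightarrow> 'm \<Rightarrow> complex"
  shows "(\<Sum>b\<in>B. \<Sum>b'\<in>B. (cmod (\<Sum>m\<in>M. w b m * cnj (w b' m)))\<^sup>2)
       = (\<Sum>m\<in>M. \<Sum>n\<in>M. (cmod (\<Sum>b\<in>B. w b m * cnj (w b n)))\<^sup>2)"
proof -
  have "complex_of_real (\<Sum>b\<in>B. \<Sum>b'\<in>B. (cmod (\<Sum>m\<in>M. w b m * cnj (w b' m)))\<^sup>2)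
      = (\<Sum>b\<in>B. \<Sum>b'\<in>B. \<Sum>m\<in>M. \<Sum>n\<in>M. w b m * cnj (w b' m) * (cnj (w b n) * w b' n))"
    by (simp add: complex_norm_square sum_product del: of_real_power)
  also have "\<dots> = (\<Sum>m\<in>M. \<Sum>n\<in>M. \<Sum>b\<in>B. \<Sum>b'\<in>B. w b m * cnj (w b' m) * (cnj (w b n) * w b' n))"
    by (simp only: sum.swap[of _ B M])
  also have "\<dots> = complex_of_real (\<Sum>m\<in>M. \<Sum>n\<in>M. (cmod (\<Sum>b\<in>B. w b m * cnj (w b n)))\<^sup>2)"
    by (simp add: complex_norm_square sum_product mult_ac del: of_real_power)
  finally show ?thesis
    by (simp only: of_real_eq_iff)
qed

text \<open>Cut the circle into \<open>A\<close> cells. Duality and the kernel bound lead to a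
  quadratic form in the cell counts \<open>N c\<close> with row sums at most 40. Schur's test bounds
  it by the sum of the \<open>(N c)\<^sup>2\<close>, which counts the pairs in a common
  cell.\<close>

lemma sum_square_differences_le:
  fixes \<theta> :: "nat \<Rightarrow> real"
  assumes "finite M" "A \<ge> 1"
  shows "(\<Sum>b<A. \<Sum>b'<A. (cmod (\<Sum>m\<in>M. e_real ((real b - real b') * \<theta> m)))\<^sup>2)
       \<le> 40 * (real A)\<^sup>2
          * real (card {(m, n) \<in> M \<times> M. \<exists>j::int. \<bar>\<theta> m - \<theta> n - real_of_int j\<bar> \<le> 1 / real A})"
proof -
  define cell where "cell m = nat \<lfloor>real A * frac (\<theta> m)\<rfloor>" for m
  define N where "N c = real (card {m \<in> M. cell m = c})" for c
  define \<kappa> where "\<kappa> c c' = (\<lambda>d. fejer_weight d + fejer_weight (A - d)) ((c - c') + (c' - c))"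
    for c c' :: nat
  have A: "real A > 0"
    using assms(2) by simp
  have cell_eq: "real (cell m) = real_of_int \<lfloor>real A * frac (\<theta> m)\<rfloor>" for m
    by (simp add: cell_def)
  have cell_lt: "cell m < A" for m
  proof -
    have "real A * frac (\<theta> m) < real A * 1"
      using A frac_lt_1 by (intro mult_strict_left_mono) auto
    then have "real (cell m) < real A"
      unfolding cell_eq by linarith
    then show ?thesis by simp
  qed
  have close: "\<bar>real A * (frac (\<theta> m) - frac (\<theta> n)) - (real (cell m) - real (cell n))\<bar> < 1" for m n
    unfolding cell_eq right_diff_distrib by linarith
  have \<kappa>_nonneg: "\<kappa> c c' \<ge> 0" for c c'
    by (simp add: \<kappa>_def fejer_weight_nonneg)
  have \<kappa>_sym: "\<kappa> c c' = \<kappa> c' c" for c c'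
    by (simp add: \<kappa>_def add.commute)
  \<comment> \<open>40 is a factor 2 for the two sides of \<open>c\<close>, times
    \<open>10 + 10\<close> for the two weights.\<close>
  have sum_\<kappa>: "(\<Sum>c'<A. \<kappa> c c') \<le> 40" if "c < A" for c
  proof -
    have "(\<Sum>c'<A. \<kappa> c c') \<le> 2 * (\<Sum>d<A. fejer_weight d + fejer_weight (A - d))"
      unfolding \<kappa>_def using that
      by (intro sum_abs_diff_le[where F = "\<lambda>d. fejer_weight d + fejer_weight (A - d)"])
         (auto simp: fejer_weight_nonneg)
    also have "\<dots> = 2 * ((\<Sum>d<A. fejer_weight d) + (\<Sum>d<A. fejer_weight (A - d)))"
      by (simp add: sum.distrib)
    finally have 1: "(\<Sum>c'<A. \<kappa> c c') \<le> 2 * ((\<Sum>d<A. fejer_weight d) + (\<Sum>d<A. fejer_weight (A - d)))" .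
    have "(\<Sum>d<A. fejer_weight (A - d)) = (\<Sum>d\<in>(\<lambda>d. A - d) ` {..<A}. fejer_weight d)"
      by (subst sum.reindex) (auto simp: inj_on_def)
    also have "\<dots> \<le> (\<Sum>d<Suc A. fejer_weight d)"
      by (intro sum_mono2) (auto simp: fejer_weight_nonneg)
    also have "\<dots> \<le> 10"
      by (rule sum_fejer_weight_le)
    finally have 2: "(\<Sum>d<A. fejer_weight (A - d)) \<le> 10" .
    have "x \<le> 40" if "x \<le> 2 * y + 2 * z" "y \<le> 10" "z \<le> 10" for x y z :: real
      using that by linarith
    from this[OF 1[unfolded distrib_left] sum_fejer_weight_le 2] show ?thesis .
  qed
  have kernel: "(cmod (\<Sum>b<A. e_real (real b * \<theta> m) * cnj (e_real (real b * \<theta> n))))\<^sup>2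
      \<le> (real A)\<^sup>2 * \<kappa> (cell m) (cell n)" for m n
  proof -
    \<comment> \<open>Integer parts drop out because \<open>b\<close> is an integer, so only the
      fractional parts, which the cells locate, matter.\<close>
    have "e_real (real b * \<theta> m) * cnj (e_real (real b * \<theta> n))
        = e_real (real b * (frac (\<theta> m) - frac (\<theta> n)))" for b
    proof -
      have "real b * \<theta> m + - (real b * \<theta> n)
          = real b * (frac (\<theta> m) - frac (\<theta> n)) + real_of_int (int b * (\<lfloor>\<theta> m\<rfloor> - \<lfloor>\<theta> n\<rfloor>))"
        by (simp add: frac_def algebra_simps)
      then show ?thesis
        unfolding cnj_e_real e_real_add[symmetric] by (simp only: e_real_add e_real_of_int mult_1_right)
    qed
    moreover have "\<bar>frac (\<theta> m) - frac (\<theta> n)\<bar> < 1"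
      using frac_lt_1[of "\<theta> m"] frac_lt_1[of "\<theta> n"] frac_ge_0[of "\<theta> m"] frac_ge_0[of "\<theta> n"]
      by linarith
    ultimately show ?thesis
      using fejer_kernel_le[OF _ close cell_lt cell_lt] by (simp add: \<kappa>_def)
  qed
  have "(\<Sum>b<A. \<Sum>b'<A. (cmod (\<Sum>m\<in>M. e_real ((real b - real b') * \<theta> m)))\<^sup>2)
      = (\<Sum>b<A. \<Sum>b'<A. (cmod (\<Sum>m\<in>M. e_real (real b * \<theta> m) * cnj (e_real (real b' * \<theta> m))))\<^sup>2)"
    by (simp add: cnj_e_real left_diff_distrib flip: e_real_add)
  also have "\<dots> = (\<Sum>m\<in>M. \<Sum>n\<in>M. (cmod (\<Sum>b<A. e_real (real b * \<theta> m) * cnj (e_real (real b * \<theta> n))))\<^sup>2)"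
    by (rule dual_square_sum)
  also have "\<dots> \<le> (\<Sum>m\<in>M. \<Sum>n\<in>M. (real A)\<^sup>2 * \<kappa> (cell m) (cell n))"
    by (intro sum_mono kernel)
  also have "\<dots> = (real A)\<^sup>2 * (\<Sum>m\<in>M. \<Sum>n\<in>M. \<kappa> (cell m) (cell n))"
    by (simp add: sum_distrib_left)
  also have "(\<Sum>m\<in>M. \<Sum>n\<in>M. \<kappa> (cell m) (cell n)) = (\<Sum>c<A. \<Sum>c'<A. N c * (N c' * \<kappa> c c'))"
    unfolding N_def using assms(1) cell_lt
    by (subst sum_cells[where g = cell and T = "{..<A}"], simp_all)
       (subst sum_cells[where g = cell and T = "{..<A}"], simp_all add: sum_distrib_left)
  \<comment> \<open>Schur's test: the inequality of arithmetic and geometric means separates the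
    counts, and the symmetry of \<open>\<kappa>\<close> makes the two halves equal.\<close>
  also have "\<dots> \<le> (\<Sum>c<A. \<Sum>c'<A. (N c)\<^sup>2 * \<kappa> c c' / 2 + (N c')\<^sup>2 * \<kappa> c c' / 2)"
  proof (intro sum_mono)
    fix c c'
    have "N c * N c' \<le> (N c)\<^sup>2 / 2 + (N c')\<^sup>2 / 2"
      using sum_squares_bound[of "N c" "N c'"] by (simp add: field_simps)
    then have "N c * N c' * \<kappa> c c' \<le> ((N c)\<^sup>2 / 2 + (N c')\<^sup>2 / 2) * \<kappa> c c'"
      using \<kappa>_nonneg by (intro mult_right_mono)
    then show "N c * (N c' * \<kappa> c c') \<le> (N c)\<^sup>2 * \<kappa> c c' / 2 + (N c')\<^sup>2 * \<kappa> c c' / 2"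
      by (simp add: algebra_simps)
  qed
  also have "\<dots> = (\<Sum>c<A. \<Sum>c'<A. (N c)\<^sup>2 * \<kappa> c c' / 2) + (\<Sum>c<A. \<Sum>c'<A. (N c')\<^sup>2 * \<kappa> c c' / 2)"
    by (simp only: sum.distrib)
  also have "(\<Sum>c<A. \<Sum>c'<A. (N c')\<^sup>2 * \<kappa> c c' / 2) = (\<Sum>c<A. \<Sum>c'<A. (N c)\<^sup>2 * \<kappa> c c' / 2)"
    by (subst sum.swap) (simp add: \<kappa>_sym)
  also have "(\<Sum>c<A. \<Sum>c'<A. (N c)\<^sup>2 * \<kappa> c c' / 2) + (\<Sum>c<A. \<Sum>c'<A. (N c)\<^sup>2 * \<kappa> c c' / 2)
      = (\<Sum>c<A. (N c)\<^sup>2 * (\<Sum>c'<A. \<kappa> c c'))"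
    by (simp add: sum_distrib_left sum_distrib_right mult.commute flip: sum.distrib)
  also have "\<dots> \<le> (\<Sum>c<A. (N c)\<^sup>2 * 40)"
    using sum_\<kappa> by (intro sum_mono mult_left_mono) auto
  also have "(\<Sum>c<A. (N c)\<^sup>2 * 40) = 40 * (\<Sum>c<A. N c * N c)"
    by (simp add: sum_distrib_left mult.commute power2_eq_square)
  also have "(\<Sum>c<A. N c * N c) = (\<Sum>m\<in>M. N (cell m))"
    unfolding N_def using assms(1) cell_lt
    by (subst sum_cells[where g = cell and T = "{..<A}" and F = "\<lambda>c. real (card {m \<in> M. cell m = c})"]) simp_all
  also have "\<dots> = real (card (SIGMA m:M. {n \<in> M. cell n = cell m}))"
    using assms(1) by (simp add: N_def)
  also have "\<dots> \<le> real (card {(m, n) \<in> M \<times> M. \<exists>j::int. \<bar>\<theta> m - \<theta> n - real_of_int j\<bar> \<le> 1 / real A})"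
  proof (intro of_nat_mono card_mono)
    show "finite {(m, n) \<in> M \<times> M. \<exists>j::int. \<bar>\<theta> m - \<theta> n - real_of_int j\<bar> \<le> 1 / real A}"
      by (rule finite_subset[of _ "M \<times> M"]) (use assms(1) in auto)
    have "\<exists>j::int. \<bar>\<theta> m - \<theta> n - real_of_int j\<bar> \<le> 1 / real A" if "cell n = cell m" for m n
    proof
      have "\<bar>real A * (frac (\<theta> m) - frac (\<theta> n))\<bar> < 1"
        using close[of m n] that by simp
      then have "real A * \<bar>frac (\<theta> m) - frac (\<theta> n)\<bar> < 1"
        by (simp add: abs_mult)
      then have "\<bar>frac (\<theta> m) - frac (\<theta> n)\<bar> \<le> 1 / real A"
        using A by (simp add: pos_le_divide_eq mult.commute)
      then show "\<bar>\<theta> m - \<theta> n - real_of_int (\<lfloor>\<theta> m\<rfloor> - \<lfloor>\<theta> n\<rfloor>)\<bar> \<le> 1 / real A"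
        by (simp add: frac_def algebra_simps)
    qed
    then show "(SIGMA m:M. {n \<in> M. cell n = cell m})
        \<subseteq> {(m, n) \<in> M \<times> M. \<exists>j::int. \<bar>\<theta> m - \<theta> n - real_of_int j\<bar> \<le> 1 / real A}"
      by auto
  qed
  finally show ?thesis
    using A by (simp add: mult_ac)
qed

text \<open>Each \<open>a\<close> in \<open>{1..N}\<close> is a difference \<open>b - b'\<close> of
  at least \<open>N\<close> pairs below \<open>2 * N\<close>, namely those with
  \<open>b' < N\<close> and \<open>b = b' + a\<close>. This produces the double sum on which duality
  acts.\<close>

lemma sum_squares_le_differences:
  fixes G :: "real \<Rightarrow> real"
  assumes "\<And>t. G t \<ge> 0"
  shows "real N * (\<Sum>a\<in>{1..N}. G (real a)) \<le> (\<Sum>b<2 * N. \<Sum>b'<2 * N. G (real b - real b'))"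
proof -
  have shift: "(\<Sum>a\<in>{1..N}. G (real (b' + a) - real b')) = (\<Sum>b\<in>(\<lambda>a. b' + a) ` {1..N}. G (real b - real b'))"
    for b'
    by (subst sum.reindex) (auto simp: inj_on_def)
  have "real N * (\<Sum>a\<in>{1..N}. G (real a)) = (\<Sum>b'<N. \<Sum>a\<in>{1..N}. G (real (b' + a) - real b'))"
    by simp
  also have "\<dots> = (\<Sum>b'<N. \<Sum>b\<in>(\<lambda>a. b' + a) ` {1..N}. G (real b - real b'))"
    by (simp only: shift)
  also have "\<dots> \<le> (\<Sum>b'<N. \<Sum>b<2 * N. G (real b - real b'))"
    using assms by (intro sum_mono sum_mono2) auto
  also have "\<dots> \<le> (\<Sum>b'<2 * N. \<Sum>b<2 * N. G (real b - real b'))"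
    using assms by (intro sum_mono2 sum_nonneg) auto
  also have "\<dots> = (\<Sum>b<2 * N. \<Sum>b'<2 * N. G (real b - real b'))"
    by (rule sum.swap)
  finally show ?thesis .
qed

text \<open>Cauchy--Schwarz, then the mean square with \<open>A = 2 * N\<close>; hence
  \<open>160 = 40 * 2\<^sup>2\<close>.\<close>

lemma sum_norm_exponential_le:
  fixes \<theta> :: "nat \<Rightarrow> real"
  assumes "finite M" "N \<ge> 1"
  shows "(\<Sum>a\<in>{1..N}. cmod (\<Sum>m\<in>M. e_real (real a * \<theta> m)))\<^sup>2 \<le> 160 * (real N)\<^sup>2
          * real (card {(m, n) \<in> M \<times> M. \<exists>j::int. \<bar>\<theta> m - \<theta> n - real_of_int j\<bar> \<le> 1 / real (2 * N)})"
    (is "_ \<le> _ * real ?E")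
proof -
  define G where "G t = (cmod (\<Sum>m\<in>M. e_real (t * \<theta> m)))\<^sup>2" for t
  have "real N * (\<Sum>a\<in>{1..N}. G (real a)) \<le> (\<Sum>b<2 * N. \<Sum>b'<2 * N. G (real b - real b'))"
    by (rule sum_squares_le_differences) (simp add: G_def)
  also have "\<dots> \<le> 40 * (real (2 * N))\<^sup>2 * real ?E"
    unfolding G_def using assms by (intro sum_square_differences_le) auto
  finally have *: "real N * (\<Sum>a\<in>{1..N}. G (real a)) \<le> 160 * (real N)\<^sup>2 * real ?E"
    by (simp add: power_mult_distrib)
  have "(\<Sum>a\<in>{1..N}. cmod (\<Sum>m\<in>M. e_real (real a * \<theta> m)))\<^sup>2
      = (\<Sum>a\<in>{1..N}. 1 * cmod (\<Sum>m\<in>M. e_real (real a * \<theta> m)))\<^sup>2"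
    by simp
  also have "\<dots> \<le> (\<Sum>a\<in>{1..N}. 1\<^sup>2) * (\<Sum>a\<in>{1..N}. (cmod (\<Sum>m\<in>M. e_real (real a * \<theta> m)))\<^sup>2)"
    by (rule Cauchy_Schwarz_ineq_sum)
  also have "\<dots> = real N * (\<Sum>a\<in>{1..N}. G (real a))"
    by (simp add: G_def)
  finally show ?thesis
    using * by linarith
qed

section \<open>Counting close pairs\<close>

text \<open>Since \<open>0 < v < q\<close>, the fraction \<open>v * u / q\<close> is not an integer,
  so it is at least \<open>1 / q\<close> away from every integer; the approximation error
  \<open>v / q\<^sup>2\<close> uses up at most half of this.\<close>

lemma multiple_far_from_int:
  fixes u q :: int and v :: nat
  assumes "q \<ge> 1" "coprime u q" "\<bar>\<alpha> - real_of_int u / real_of_int q\<bar> < 1 / (real_of_int q)\<^sup>2"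
    and "v \<ge> 1" "2 * real v \<le> real_of_int q"
  shows "\<bar>real v * \<alpha> - real_of_int j\<bar> \<ge> 1 / (2 * real_of_int q)"
proof -
  have q: "real_of_int q > 0"
    using assms(1) by simp
  have "\<not> q dvd int v * u"
  proof
    assume "q dvd int v * u"
    then have "q dvd int v"
      using assms(2) by (simp add: coprime_commute coprime_dvd_mult_left_iff)
    then have "q \<le> int v"
      using assms(4) by (intro zdvd_imp_le) auto
    then show False
      using assms(4,5) by linarith
  qed
  then have "int v * u - j * q \<noteq> 0"
    by auto
  then have "1 \<le> \<bar>int v * u - j * q\<bar>"
    by linarith
  then have "1 \<le> \<bar>real v * real_of_int u - real_of_int j * real_of_int q\<bar>"
    by (metis (no_types, lifting) of_int_1_le_iff of_int_abs of_int_diff of_int_mult of_int_of_nat_eq)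
  note 1 = this
  have 2: "1 / real_of_int q \<le> \<bar>real v * real_of_int u / real_of_int q - real_of_int j\<bar>"
  proof -
    have "real v * real_of_int u / real_of_int q - real_of_int j
        = (real v * real_of_int u - real_of_int j * real_of_int q) / real_of_int q"
      using q by (simp add: field_simps)
    then show ?thesis
      using 1 q by (simp add: abs_divide divide_right_mono)
  qed
  have "\<bar>real v * \<alpha> - real v * real_of_int u / real_of_int q\<bar>
      = \<bar>real v * (\<alpha> - real_of_int u / real_of_int q)\<bar>"
    by (simp add: right_diff_distrib)
  also have "\<dots> = real v * \<bar>\<alpha> - real_of_int u / real_of_int q\<bar>"
    by (simp add: abs_mult)
  also have "\<dots> \<le> (real_of_int q / 2) * (1 / (real_of_int q)\<^sup>2)"
    using assms(3,5) by (intro mult_mono) auto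
  also have "\<dots> = 1 / (2 * real_of_int q)"
    using q by (simp add: power2_eq_square)
  finally have "\<bar>real v * \<alpha> - real v * real_of_int u / real_of_int q\<bar> \<le> 1 / (2 * real_of_int q)" .
  then have 3: "\<bar>real v * \<alpha> - real v * real_of_int u / real_of_int q\<bar> \<le> 1 / (2 * real_of_int q)" .
  have half: "2 * (1 / (2 * real_of_int q)) = 1 / real_of_int q"
    by simp
  have tri: "e \<le> \<bar>a - c\<bar>" if "\<bar>a - b\<bar> \<le> e" "2 * e \<le> \<bar>b - c\<bar>" for a b c e :: real
    using that by linarith
  show ?thesis
    by (rule tri[OF 3]) (unfold half, rule 2)
qed

text \<open>The difference of two distinct elements is, up to sign, again in \<open>{1..N}\<close>,
  so their offsets from nearby integers differ by at least \<open>1 / (2 * q)\<close>. The offsets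
  lie in an interval of length \<open>2 * \<rho>\<close>; scaled by \<open>2 * q\<close>, they have
  distinct floors.\<close>

lemma card_near_int_le:
  fixes \<beta> \<rho> q :: real
  assumes "q > 0" "\<rho> \<ge> 0"
    and far: "\<And>v j. v \<in> {1..N} \<Longrightarrow> \<bar>real v * \<beta> - real_of_int j\<bar> \<ge> 1 / (2 * q)"
  shows "real (card {W \<in> {1..N}. \<exists>j::int. \<bar>real W * \<beta> - real_of_int j\<bar> \<le> \<rho>}) \<le> 4 * q * \<rho> + 1"
proof -
  define M where "M = {W \<in> {1..N}. \<exists>j::int. \<bar>real W * \<beta> - real_of_int j\<bar> \<le> \<rho>}"
  obtain i :: "nat \<Rightarrow> int" where i: "\<And>W. W \<in> M \<Longrightarrow> \<bar>real W * \<beta> - real_of_int (i W)\<bar> \<le> \<rho>"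
  proof -
    have "\<forall>W\<in>M. \<exists>j::int. \<bar>real W * \<beta> - real_of_int j\<bar> \<le> \<rho>"
      by (simp add: M_def)
    then show thesis
      using that by metis
  qed
  define g where "g W = \<lfloor>2 * q * (real W * \<beta> - real_of_int (i W) + \<rho>)\<rfloor>" for W
  have neq: "g W \<noteq> g W'" if "W \<in> M" "W' \<in> M" "W' < W" for W W'
  proof
    assume "g W = g W'"
    then have "\<bar>2 * q * (real W * \<beta> - real_of_int (i W) + \<rho>) - 2 * q * (real W' * \<beta> - real_of_int (i W') + \<rho>)\<bar> < 1"
      unfolding g_def by linarith
    also have "2 * q * (real W * \<beta> - real_of_int (i W) + \<rho>) - 2 * q * (real W' * \<beta> - real_of_int (i W') + \<rho>)
        = 2 * q * (real (W - W') * \<beta> - real_of_int (i W - i W'))"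
      using that(3) by (simp add: of_nat_diff algebra_simps)
    finally have "2 * q * \<bar>real (W - W') * \<beta> - real_of_int (i W - i W')\<bar> < 1"
      using assms(1) by (simp add: abs_mult)
    moreover have "\<bar>real (W - W') * \<beta> - real_of_int (i W - i W')\<bar> \<ge> 1 / (2 * q)"
      using that by (intro far) (auto simp: M_def)
    ultimately show False
      using assms(1) by (simp add: field_simps)
  qed
  have inj: "inj_on g M"
    by (rule inj_onI) (metis neq linorder_neqE_nat)
  have "g ` M \<subseteq> {0..\<lfloor>4 * q * \<rho>\<rfloor>}"
  proof
    fix y assume "y \<in> g ` M"
    then obtain W where W: "W \<in> M" "y = g W" by blast
    have r: "0 \<le> real W * \<beta> - real_of_int (i W) + \<rho>" "real W * \<beta> - real_of_int (i W) + \<rho> \<le> 2 * \<rho>"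
      using i[OF W(1)] by linarith+
    have "2 * q * (real W * \<beta> - real_of_int (i W) + \<rho>) \<le> 2 * q * (2 * \<rho>)"
      using assms(1) r(2) by (intro mult_left_mono) auto
    then have "y \<le> \<lfloor>4 * q * \<rho>\<rfloor>"
      unfolding W(2) g_def by (intro floor_mono) (simp add: mult_ac)
    moreover have "0 \<le> y"
      unfolding W(2) g_def using assms(1) r(1) by simp
    ultimately show "y \<in> {0..\<lfloor>4 * q * \<rho>\<rfloor>}" by simp
  qed
  then have "card M \<le> card {0..\<lfloor>4 * q * \<rho>\<rfloor>}"
    by (intro card_inj_on_le[OF inj]) auto
  then have "card M \<le> nat (\<lfloor>4 * q * \<rho>\<rfloor> + 1)"
    by simp
  moreover have "0 \<le> \<lfloor>4 * q * \<rho>\<rfloor>"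
    using assms(1,2) by simp
  ultimately have "int (card M) \<le> \<lfloor>4 * q * \<rho>\<rfloor> + 1"
    by linarith
  then have "real (card M) \<le> real_of_int (\<lfloor>4 * q * \<rho>\<rfloor> + 1)"
    by linarith
  also have "\<dots> \<le> 4 * q * \<rho> + 1"
    by simp
  finally show ?thesis
    by (simp add: M_def)
qed

section \<open>From points in blocks to tuples\<close>

lemma le_add_choose: "n \<le> k + (n choose Suc k)"
proof (induction n)
  case (Suc n)
  show ?case
  proof (cases "k \<le> n")
    case True
    then have "(n choose k) \<ge> 1"
      by (simp add: Suc_leI)
    then show ?thesis
      using Suc by (simp only: binomial_Suc_Suc)
  qed simp
qed simp

lemma degree_coeff_shift_diff:
  fixes P :: "real poly"
  assumes "degree P = Suc d"
  shows "degree (P \<circ>\<^sub>p [:h, 1:] - P) < Suc d"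
    and "coeff (P \<circ>\<^sub>p [:h, 1:] - P) d = real (Suc d) * h * coeff P (Suc d)"
proof -
  have "degree (P \<circ>\<^sub>p [:h, 1:]) = Suc d"
    using assms by (simp add: degree_pcompose)
  then have "degree (P \<circ>\<^sub>p [:h, 1:] - P) \<le> Suc d"
    using assms by (intro degree_diff_le) auto
  moreover have "coeff (P \<circ>\<^sub>p [:h, 1:] - P) (Suc d) = 0"
    using coeff_pcompose_shift[of P "Suc d" h] assms by (simp add: coeff_eq_0)
  ultimately show "degree (P \<circ>\<^sub>p [:h, 1:] - P) < Suc d"
    by (metis coeff_0_degree_minus_1 diff_less le_neq_implies_less leading_coeff_0_iff
        lessI degree_0 zero_less_Suc)
  show "coeff (P \<circ>\<^sub>p [:h, 1:] - P) d = real (Suc d) * h * coeff P (Suc d)"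
    using coeff_pcompose_shift[of P d h] assms by simp
qed

text \<open>Split by \<open>n div L\<close>. By \<open>le_add_choose\<close> a block has at most
  \<open>d\<close> points plus the number of its subsets of size \<open>Suc d\<close>, which turns a
  count of points into a count of tuples.\<close>

lemma card_le_blocks:
  fixes N :: "nat set"
  assumes "N \<subseteq> {1..X}"
  shows "card N \<le> (X div L + 1) * d
           + (\<Sum>c\<le>X div L. card {S. S \<subseteq> {n \<in> N. n div L = c} \<and> card S = Suc d})"
proof -
  have fin: "finite N"
    using assms by (rule finite_subset) simp
  have "card N = (\<Sum>n\<in>N. 1)"
    by simp
  also have "\<dots> = (\<Sum>c\<le>X div L. \<Sum>n\<in>{n \<in> N. n div L = c}. 1)"
    using fin assms by (intro sum.group[symmetric]) (auto intro!: div_le_mono)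
  also have "\<dots> = (\<Sum>c\<le>X div L. card {n \<in> N. n div L = c})"
    by simp
  also have "\<dots> \<le> (\<Sum>c\<le>X div L. d + card {S. S \<subseteq> {n \<in> N. n div L = c} \<and> card S = Suc d})"
    using fin le_add_choose by (intro sum_mono) (simp add: n_subsets)
  finally show ?thesis
    by (simp add: sum.distrib)
qed

text \<open>A tuple \<open>S\<close> together with the shift \<open>h\<close> is recovered from its least element and
  divisors of \<open>vandermonde S * h\<close>, since all differences of elements of \<open>S\<close> divide
  \<open>vandermonde S\<close>.\<close>

lemma card_tuples_le:
  fixes \<Omega> :: "(nat \<times> nat set) set" and D :: nat
  assumes "d \<ge> 1"
    and \<Omega>: "\<And>h S. (h, S) \<in> \<Omega> \<Longrightarrow> h \<ge> 1 \<and> S \<subseteq> {1..X} \<and> card S = Suc d \<and> vandermonde S * h \<in> V"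
    and "finite V" "0 \<notin> V"
    and D: "\<And>W. W \<in> V \<Longrightarrow> card {d. d dvd W} \<le> D"
  shows "card \<Omega> \<le> card V * X * D ^ Suc d"
proof -
  define T where "T = (SIGMA W:V. {1..X} \<times> {h. h dvd W} \<times> {B. B \<subseteq> {b. b dvd W} \<and> card B = d})"
  define \<phi> where "\<phi> = (\<lambda>(h, S). (vandermonde S * h, Min S, h, (\<lambda>s. s - Min S) ` (S - {Min S})))"
  have fin_dvd: "finite {h. h dvd W}" if "W \<in> V" for W
  proof -
    have "W > 0"
      using that assms(4) by (cases W) auto
    then show ?thesis by simp
  qed
  have fin_sub: "finite {B. B \<subseteq> {b. b dvd W} \<and> card B = d}" if "W \<in> V" for W
  proof (rule finite_subset)
    show "{B. B \<subseteq> {b. b dvd W} \<and> card B = d} \<subseteq> Pow {b. b dvd W}"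
      by blast
    show "finite (Pow {b. b dvd W})"
      using fin_dvd[OF that] by (simp only: finite_Pow_iff)
  qed
  have S: "finite S" "S \<noteq> {}" "Min S \<in> S" "\<And>s. s \<in> S \<Longrightarrow> Min S \<le> s" if "(h, S) \<in> \<Omega>" for h S
  proof -
    have sub: "S \<subseteq> {1..X}" and card: "card S = Suc d"
      using \<Omega>[OF that] by blast+
    show fin: "finite S"
      by (rule finite_subset[OF sub]) simp
    show ne: "S \<noteq> {}"
      using card by (metis card.empty nat.distinct(1))
    show "Min S \<in> S"
      using fin ne by (rule Min_in)
    show "Min S \<le> s" if "s \<in> S" for s
      using fin that by (rule Min_le)
  qed
  have "inj_on \<phi> \<Omega>"
  proof (rule inj_onI)
    fix a b assume ab: "a \<in> \<Omega>" "b \<in> \<Omega>" "\<phi> a = \<phi> b"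
    obtain h S where a: "a = (h, S)" by fastforce
    obtain h' S' where b: "b = (h', S')" by fastforce
    define g where "g n B = insert n ((\<lambda>b. n + b) ` B)" for n :: nat and B
    have rec: "g (Min S) ((\<lambda>s. s - Min S) ` (S - {Min S})) = S" if "(h, S) \<in> \<Omega>" for h S
    proof -
      have "Min S + (s - Min S) = s" if "s \<in> S - {Min S}" for s
        using S(4)[OF \<open>(h, S) \<in> \<Omega>\<close>, of s] that by simp
      then have "(\<lambda>b. Min S + b) ` (\<lambda>s. s - Min S) ` (S - {Min S}) = S - {Min S}"
        unfolding image_image by simp
      then show ?thesis
        unfolding g_def using S(3)[OF that] by (simp only: insert_Diff)
    qed
    have *: "vandermonde S * h = vandermonde S' * h' \<and> Min S = Min S' \<and> h = h' \<and>
      (\<lambda>s. s - Min S) ` (S - {Min S}) = (\<lambda>s. s - Min S') ` (S' - {Min S'})"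
      using ab(3) unfolding \<phi>_def a b prod.case prod.inject .
    have "S = g (Min S) ((\<lambda>s. s - Min S) ` (S - {Min S}))"
      using rec ab(1) unfolding a by blast
    also have "\<dots> = g (Min S') ((\<lambda>s. s - Min S') ` (S' - {Min S'}))"
      by (intro arg_cong2[of _ _ _ _ g]) (use * in blast)+
    also have "\<dots> = S'"
      using rec ab(2) unfolding b by blast
    finally show "a = b"
      using * unfolding a b by blast
  qed
  moreover have "\<phi> ` \<Omega> \<subseteq> T"
  proof
    fix y assume "y \<in> \<phi> ` \<Omega>"
    then obtain h S where hS: "(h, S) \<in> \<Omega>" and y: "y = \<phi> (h, S)"
      by force
    have "(\<lambda>s. s - Min S) ` (S - {Min S}) \<subseteq> {b. b dvd vandermonde S * h}"
    proof
      fix b assume "b \<in> (\<lambda>s. s - Min S) ` (S - {Min S})"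
      then obtain s where s: "s \<in> S" "s \<noteq> Min S" "b = s - Min S"
        by auto
      then have "Min S < s"
        using S(4)[OF hS s(1)] by simp
      then have "b dvd vandermonde S"
        unfolding s(3) using S[OF hS] s(1) by (intro diff_dvd_vandermonde) auto
      then show "b \<in> {b. b dvd vandermonde S * h}"
        by simp
    qed
    moreover have "card ((\<lambda>s. s - Min S) ` (S - {Min S})) = d"
    proof -
      have "inj_on (\<lambda>s. s - Min S) (S - {Min S})"
        using S(4)[OF hS] by (intro inj_onI) (metis Diff_iff eq_diff_iff)
      then show ?thesis
        using \<Omega>[OF hS] S[OF hS] by (simp add: card_image)
    qed
    ultimately show "y \<in> T"
      using \<Omega>[OF hS] S(3)[OF hS] unfolding y T_def \<phi>_def by auto
  qed
  moreover have finT: "finite T"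
    unfolding T_def using fin_dvd fin_sub assms(3)
    by (intro finite_SigmaI finite_cartesian_product finite_atLeastAtMost) auto
  ultimately have "card \<Omega> \<le> card T"
    by (intro card_inj_on_le)
  also have "card T = (\<Sum>W\<in>V. X * (card {h. h dvd W} * (card {h. h dvd W} choose d)))"
    unfolding T_def using fin_dvd fin_sub assms(3)
    by (subst card_SigmaI) (auto simp: card_cartesian_product n_subsets)
  \<comment> \<open>For each \<open>W\<close> there are \<open>X\<close> least elements, at most
    \<open>D\<close> shifts and at most \<open>D ^ d\<close> sets of \<open>d\<close> differences
    from the least element.\<close>
  also have "\<dots> \<le> (\<Sum>W\<in>V. X * (D * D ^ d))"
  proof (intro sum_mono mult_le_mono le_refl)
    fix W assume W: "W \<in> V"
    then show "card {h. h dvd W} \<le> D" by (rule D)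
    have "(card {h. h dvd W} choose d) \<le> card {h. h dvd W} ^ d"
      by (cases "d \<le> card {h. h dvd W}") (auto intro: binomial_le_pow simp: binomial_eq_0)
    also have "\<dots> \<le> D ^ d"
      using D[OF W] by (rule power_mono) simp
    finally show "(card {h. h dvd W} choose d) \<le> D ^ d" .
  qed
  finally show ?thesis
    by (simp add: mult_ac)
qed

text \<open>Off-diagonal pairs are grouped by their distance \<open>h\<close>. Each block
  contributes \<open>d\<close>, whence the term in \<open>X / L + 1\<close>, plus its tuples, which
  \<open>card_tuples_le\<close> counts through the products \<open>W\<close> in \<open>V\<close>.
  The lower bound on \<open>q\<close> keeps these \<open>W\<close> in the range of the spacing
  lemma.\<close>

lemma card_close_pairs_le:
  fixes P :: "real poly" and X L A z d D :: nat and u q :: int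
  assumes deg: "degree P = Suc d" and "d \<ge> 1" "L \<ge> 1" "A \<ge> 1" "z \<ge> 1"
    and q: "q \<ge> 1" "coprime u q"
      "\<bar>coeff P (Suc d) - real_of_int u / real_of_int q\<bar> < 1 / (real_of_int q)\<^sup>2"
    and small: "2 * real (Suc d * z * (X * L ^ (Suc d * d div 2))) \<le> real_of_int q"
    and D: "\<And>W. W \<in> {1..X * L ^ (Suc d * d div 2)} \<Longrightarrow> card {d. d dvd W} \<le> D"
  shows "real (card {(m, n) \<in> {1..X} \<times> {1..X}. \<exists>j::int.
             \<bar>real z * poly P (real m) - real z * poly P (real n) - real_of_int j\<bar> \<le> 1 / real A})
       \<le> real X + 2 * (real X * ((real X / real L + 1) * real d)
           + real X * real D ^ Suc d
             * (4 * real_of_int q * (real (Suc d) * real L ^ (d * (d - 1) div 2) / real A) + 1))"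
proof -
  define near :: "real \<Rightarrow> bool" where "near y \<longleftrightarrow> (\<exists>j::int. \<bar>y - real_of_int j\<bar> \<le> 1 / real A)" for y
  define f where "f h = smult (real z) (P \<circ>\<^sub>p [:real h, 1:] - P)" for h :: nat
  define N where "N h = {n. 1 \<le> n \<and> n + h \<le> X \<and> near (poly (f h) (real n))}" for h
  define \<rho> where "\<rho> = real (Suc d) * real L ^ (d * (d - 1) div 2) / real A"
  define Wmax where "Wmax = X * L ^ (Suc d * d div 2)"
  define \<beta> where "\<beta> = real (z * Suc d) * coeff P (Suc d)"
  define V where "V = {W \<in> {1..Wmax}. \<exists>j::int. \<bar>real W * \<beta> - real_of_int j\<bar> \<le> \<rho>}"
  define \<T> where "\<T> h c = {S. S \<subseteq> {n \<in> N h. n div L = c} \<and> card S = Suc d}" for h c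
  have poly_f: "poly (f h) x = real z * poly P (x + real h) - real z * poly P x" for h x
    by (simp add: f_def poly_pcompose add.commute right_diff_distrib)
  have N_sub: "N h \<subseteq> {1..X}" for h
    by (auto simp: N_def)
  have finN: "finite (N h)" for h
    using N_sub by (rule finite_subset) simp
  have near_minus: "near (- y) \<longleftrightarrow> near y" for y
  proof -
    have "near (- y)" if "near y" for y
    proof -
      from that obtain j :: int where "\<bar>y - real_of_int j\<bar> \<le> 1 / real A"
        unfolding near_def by blast
      then have "\<bar>- y - real_of_int (- j)\<bar> \<le> 1 / real A"
        by simp
      then show ?thesis
        unfolding near_def by blast
    qed
    from this[of y] this[of "- y"] show ?thesis by auto
  qed

  have cardV: "real (card V) \<le> 4 * real_of_int q * \<rho> + 1"
    unfolding V_def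
  proof (rule card_near_int_le)
    fix v :: nat and j :: int assume v: "v \<in> {1..Wmax}"
    \<comment> \<open>\<open>v * \<beta>\<close> is the multiple of the leading coefficient of
      \<open>P\<close> by the integer \<open>v * z * Suc d\<close>, to which the spacing lemma
      applies.\<close>
    have "2 * real (v * (z * Suc d)) \<le> 2 * real (Suc d * z * Wmax)"
      using v by (simp add: mult_ac del: of_nat_mult of_nat_Suc mult_Suc mult_Suc_right)
    also have "\<dots> \<le> real_of_int q"
      using small by (simp add: Wmax_def)
    finally have "\<bar>real (v * (z * Suc d)) * coeff P (Suc d) - real_of_int j\<bar> \<ge> 1 / (2 * real_of_int q)"
      using v assms(5) by (intro multiple_far_from_int[OF q]) auto
    then show "1 / (2 * real_of_int q) \<le> \<bar>real v * \<beta> - real_of_int j\<bar>"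
      by (simp add: \<beta>_def mult.assoc)
  qed (use q \<open>A \<ge> 1\<close> in \<open>auto simp: \<rho>_def\<close>)

  define \<Omega> where "\<Omega> = (SIGMA h:{1..X}. \<Union>c\<le>X div L. \<T> h c)"
  have tuple: "vandermonde S * h \<in> V" "S \<subseteq> {1..X}" "card S = Suc d"
    if S: "S \<in> \<T> h c" and h: "h \<in> {1..X}" for S h c
  proof -
    show sub: "S \<subseteq> {1..X}" and card: "card S = Suc d"
      using S N_sub by (auto simp: \<T>_def)
    have fin: "finite S"
      using sub by (rule finite_subset) simp
    have diam: "s - t \<le> L" if "s \<in> S" "t \<in> S" for s t
    proof -
      have "s div L = t div L"
        using S that by (auto simp: \<T>_def)
      then have "s - t = s mod L - t mod L"
        by (metis add_diff_cancel_left div_mult_mod_eq)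
      then show ?thesis
        using mod_less_divisor[of L s] \<open>L \<ge> 1\<close> by linarith
    qed
    have degf: "degree (f h) < card S"
      unfolding f_def card
      using degree_coeff_shift_diff(1)[OF deg] by (metis degree_smult_le le_less_trans)
    have "\<exists>j::int. \<bar>real (vandermonde S) * coeff (f h) (card S - 1) - real_of_int j\<bar>
        \<le> real (card S) * real L ^ ((card S - 1) * (card S - 2) div 2) * (1 / real A)"
    proof (rule vandermonde_mult_coeff_near_int[OF fin degf _ diam])
      fix s assume "s \<in> S"
      then have "near (poly (f h) (real s))"
        using S by (auto simp: \<T>_def N_def)
      then show "\<exists>j::int. \<bar>poly (f h) (real s) - real_of_int j\<bar> \<le> 1 / real A"
        by (simp add: near_def)
    qed auto
    \<comment> \<open>The top coefficient of \<open>f h\<close> is \<open>h * \<beta>\<close>, so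
      the shift and the Vandermonde determinant merge into one integer multiplier.\<close>
    also have "real (vandermonde S) * coeff (f h) (card S - 1) = real (vandermonde S * h) * \<beta>"
      unfolding card f_def \<beta>_def coeff_smult diff_Suc_1 degree_coeff_shift_diff(2)[OF deg]
      by (simp only: of_nat_mult mult_ac)
    also have "real (card S) * real L ^ ((card S - 1) * (card S - 2) div 2) * (1 / real A) = \<rho>"
      unfolding card \<rho>_def by (simp add: numeral_2_eq_2)
    finally have 1: "\<exists>j::int. \<bar>real (vandermonde S * h) * \<beta> - real_of_int j\<bar> \<le> \<rho>" .
    have "vandermonde S \<le> L ^ (card S * (card S - 1) div 2)"
      by (rule vandermonde_le[OF fin diam])
    then have "vandermonde S * h \<le> Wmax"
      unfolding Wmax_def card using h by (subst mult.commute) (intro mult_le_mono; simp)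
    then show "vandermonde S * h \<in> V"
      using 1 h vandermonde_pos[OF fin] by (simp add: V_def Suc_leI)
  qed
  have card\<Omega>: "card \<Omega> \<le> card V * X * D ^ Suc d"
  proof (rule card_tuples_le[OF \<open>d \<ge> 1\<close>])
    show "finite V" "0 \<notin> V"
      by (auto simp: V_def)
    show "card {d. d dvd W} \<le> D" if "W \<in> V" for W
      using that D by (simp add: V_def Wmax_def)
    show "h \<ge> 1 \<and> S \<subseteq> {1..X} \<and> card S = Suc d \<and> vandermonde S * h \<in> V" if "(h, S) \<in> \<Omega>" for h S
    proof -
      from that obtain c where h: "h \<in> {1..X}" and "S \<in> \<T> h c"
        unfolding \<Omega>_def by blast
      from tuple[OF this(2,1)] h show ?thesis by simp
    qed
  qed
  have fin\<T>: "finite (\<T> h c)" for h c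
    unfolding \<T>_def by (rule finite_subset[of _ "Pow (N h)"]) (use finN in auto)
  have card\<Omega>_eq: "card \<Omega> = (\<Sum>h\<in>{1..X}. \<Sum>c\<le>X div L. card (\<T> h c))"
  proof -
    \<comment> \<open>Different blocks have disjoint families of tuples: a tuple is nonempty, and
      any of its elements fixes the block.\<close>
    have "card (\<Union>c\<le>X div L. \<T> h c) = (\<Sum>c\<le>X div L. card (\<T> h c))" for h
    proof (rule card_UN_disjoint)
      show "\<forall>i\<in>{..X div L}. \<forall>j\<in>{..X div L}. i \<noteq> j \<longrightarrow> \<T> h i \<inter> \<T> h j = {}"
      proof (intro ballI impI equals0I)
        fix i j S assume "i \<noteq> j" and S: "S \<in> \<T> h i \<inter> \<T> h j"
        then have "S \<noteq> {}"
          by (auto simp: \<T>_def)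
        then obtain s where "s \<in> S" by blast
        then show False
          using S \<open>i \<noteq> j\<close> by (auto simp: \<T>_def)
      qed
    qed (use fin\<T> in auto)
    then show ?thesis
      unfolding \<Omega>_def using fin\<T> by (subst card_SigmaI) auto
  qed

  have sumN: "(\<Sum>h\<in>{1..X}. card (N h)) \<le> X * ((X div L + 1) * d) + card \<Omega>"
  proof -
    have "(\<Sum>h\<in>{1..X}. card (N h)) \<le> (\<Sum>h\<in>{1..X}. (X div L + 1) * d + (\<Sum>c\<le>X div L. card (\<T> h c)))"
      unfolding \<T>_def by (intro sum_mono card_le_blocks N_sub)
    then show ?thesis
      by (simp only: card\<Omega>_eq sum.distrib sum_constant card_atLeastAtMost diff_Suc_1 of_nat_id)
  qed

  let ?E = "{(m, n) \<in> {1..X} \<times> {1..X}. \<exists>j::int.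
             \<bar>real z * poly P (real m) - real z * poly P (real n) - real_of_int j\<bar> \<le> 1 / real A}"
  \<comment> \<open>The diagonal, the pairs with \<open>m > n\<close> and those with
    \<open>m < n\<close>. By \<open>near_minus\<close> the last kind has the same index set as the
    second, whence the factor 2.\<close>
  have "?E \<subseteq> (\<lambda>m. (m, m)) ` {1..X} \<union> ((\<lambda>(h, n). (n + h, n)) ` (SIGMA h:{1..X}. N h)
                \<union> (\<lambda>(h, n). (n, n + h)) ` (SIGMA h:{1..X}. N h))"
  proof
    fix p assume "p \<in> ?E"
    then obtain m n where p: "p = (m, n)" "m \<in> {1..X}" "n \<in> {1..X}"
      and nr: "near (real z * poly P (real m) - real z * poly P (real n))"
      unfolding near_def by blast
    consider "m = n" | "m > n" | "m < n" by linarith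
    then show "p \<in> (\<lambda>m. (m, m)) ` {1..X} \<union> ((\<lambda>(h, n). (n + h, n)) ` (SIGMA h:{1..X}. N h)
                \<union> (\<lambda>(h, n). (n, n + h)) ` (SIGMA h:{1..X}. N h))"
    proof cases
      case 1
      then show ?thesis using p by auto
    next
      case 2
      then have "n \<in> N (m - n)"
        using p nr by (auto simp: N_def poly_f of_nat_diff)
      then have "p = (\<lambda>(h, n). (n + h, n)) (m - n, n)" "(m - n, n) \<in> (SIGMA h:{1..X}. N h)"
        using 2 p by auto
      then show ?thesis by blast
    next
      case 3
      have "near (real z * poly P (real n) - real z * poly P (real m))"
        using nr near_minus[of "real z * poly P (real m) - real z * poly P (real n)"] by simp
      then have "m \<in> N (n - m)"
        using p 3 by (auto simp: N_def poly_f of_nat_diff)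
      then have "p = (\<lambda>(h, n). (n, n + h)) (n - m, m)" "(n - m, m) \<in> (SIGMA h:{1..X}. N h)"
        using 3 p by auto
      then show ?thesis by blast
    qed
  qed
  then have "card ?E \<le> card ((\<lambda>m. (m, m)) ` {1..X} \<union> ((\<lambda>(h, n). (n + h, n)) ` (SIGMA h:{1..X}. N h)
                \<union> (\<lambda>(h, n). (n, n + h)) ` (SIGMA h:{1..X}. N h)))"
    using finN by (intro card_mono) auto
  also have "\<dots> \<le> card ((\<lambda>m::nat. (m, m)) ` {1..X}) + (card ((\<lambda>(h, n). (n + h, n)) ` (SIGMA h:{1..X}. N h))
                + card ((\<lambda>(h, n). (n, n + h)) ` (SIGMA h:{1..X}. N h)))"
    by (intro order_trans[OF card_Un_le] add_mono order_refl)
  also have "\<dots> \<le> X + (card (SIGMA h:{1..X}. N h) + card (SIGMA h:{1..X}. N h))"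
    using finN by (intro add_mono card_image_le order_trans[OF card_image_le]) auto
  also have "card (SIGMA h:{1..X}. N h) = (\<Sum>h\<in>{1..X}. card (N h))"
    using finN by (subst card_SigmaI) auto
  also have "X + ((\<Sum>h\<in>{1..X}. card (N h)) + (\<Sum>h\<in>{1..X}. card (N h)))
      \<le> X + 2 * (X * ((X div L + 1) * d) + card V * X * D ^ Suc d)"
    unfolding mult_2 using order_trans[OF sumN add_left_mono[OF card\<Omega>]]
    by (intro add_mono order_refl)
  finally have "card ?E \<le> X + 2 * (X * ((X div L + 1) * d) + card V * X * D ^ Suc d)" .
  then have "real (card ?E) \<le> real (X + 2 * (X * ((X div L + 1) * d) + card V * X * D ^ Suc d))"
    by (rule of_nat_mono)
  also have "\<dots> = real X + 2 * (real X * ((real (X div L) + 1) * real d) + real X * real D ^ Suc d * real (card V))"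
    by (simp add: algebra_simps)
  also have "\<dots> \<le> real X + 2 * (real X * ((real X / real L + 1) * real d)
      + real X * real D ^ Suc d * (4 * real_of_int q * \<rho> + 1))"
    using cardV by (intro add_mono mult_left_mono mult_right_mono of_nat_div_le_of_nat) auto
  finally show ?thesis
    by (simp only: \<rho>_def)
qed

section \<open>Optimising the block length\<close>

lemma s0_Suc: "s0 (Suc d) = d * (d - 1) div 2 + 1"
  by (simp add: s0_def numeral_2_eq_2)

text \<open>\<open>Suc d\<close> points form \<open>d * (d - 1) div 2 + d\<close> pairs. This lets a
  full power \<open>L ^ s0 (Suc d)\<close> split off from the Vandermonde bound, to be cancelled
  against \<open>\<delta>\<close>.\<close>

lemma triangular_eq_s0: "d \<ge> 1 \<Longrightarrow> Suc d * d div 2 = s0 (Suc d) + (d - 1)"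
proof -
  assume "d \<ge> 1"
  then have "Suc d * d = d * (d - 1) + 2 * d"
    by (cases d) (auto simp: algebra_simps)
  moreover have "(d * (d - 1) + 2 * d) div 2 = d * (d - 1) div 2 + d"
    by (simp only: div_mult_self2[OF zero_neq_numeral[symmetric]] add.commute)
  ultimately show ?thesis
    using \<open>d \<ge> 1\<close> by (simp add: s0_Suc)
qed

text \<open>The block length \<open>L\<close> is chosen to balance the two terms of the bound in
  \<open>card_close_pairs_le\<close>.\<close>

lemma card_close_pairs_powr_le:
  fixes P :: "real poly" and d N z :: nat and u q :: int and x T \<delta> \<epsilon> C \<eta> :: real
  assumes deg: "degree P = Suc d" and d: "d \<ge> 2" and "z \<ge> 1" and "N \<ge> 1"
    and q: "q \<ge> 1" "coprime u q"
      "\<bar>coeff P (Suc d) - real_of_int u / real_of_int q\<bar> < 1 / (real_of_int q)\<^sup>2"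
    and x: "x \<ge> (2 * real (Suc d))\<^sup>2" and N: "T \<le> real (2 * N)" "T > 0"
    and \<delta>: "\<delta> < 1" "\<delta> \<ge> 1 / x" "real z * x ^ d \<le> \<delta> * real_of_int q" "real_of_int q \<le> \<delta> * (T * x)"
    and "\<epsilon> > 0" and \<eta>: "\<eta> = \<epsilon> / (real (Suc d) * (1 + real (Suc d * d)))"
    and C: "C \<ge> 1" "\<And>n::nat. n > 0 \<Longrightarrow> real (card {d. d dvd n}) \<le> C * real n powr \<eta>"
  defines "X \<equiv> nat \<lfloor>x\<rfloor>" and "s \<equiv> s0 (Suc d)"
  shows "real (card {(m, n) \<in> {1..X} \<times> {1..X}. \<exists>j::int.
             \<bar>real z * poly P (real m) - real z * poly P (real n) - real_of_int j\<bar> \<le> 1 / real (2 * N)})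
       \<le> 2 * (1 + 4 * real d + 2 * (4 * real (Suc d) + 1) * C ^ Suc d)
           * (x\<^sup>2 * x powr \<epsilon> * \<delta> powr (1 / real s))"
proof -
  \<comment> \<open>Then \<open>y ^ s = 1 / \<delta>\<close>, the largest scale with
    \<open>y ^ s * \<delta> \<le> 1\<close>; as \<open>y > 1\<close>, its integer part
    \<open>L\<close> loses at most a factor 2.\<close>
  define y where "y = \<delta> powr (- 1 / real s)"
  define L where "L = nat \<lfloor>y\<rfloor>"
  define Wmax where "Wmax = X * L ^ (Suc d * d div 2)"
  define D where "D = nat \<lfloor>C * real Wmax powr \<eta>\<rfloor>"
  have "(2 * real (Suc d))\<^sup>2 \<ge> 2\<^sup>2"
    by (intro power_mono) auto
  then have x4: "x \<ge> 4"
    using x by simp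
  have \<delta>pos: "\<delta> > 0"
    using \<delta>(2) x4 by (smt (verit) divide_pos_pos)
  have s: "s \<ge> 2"
  proof -
    have "d * (d - 1) \<ge> 2 * 1"
      using d by (intro mult_le_mono) auto
    then have "d * (d - 1) div 2 \<ge> 1"
      by linarith
    then show ?thesis
      by (simp add: s_def s0_Suc)
  qed
  have y1: "y > 1"
    unfolding y_def using powr_less_mono2_neg[of "- 1 / real s" \<delta> 1] \<delta>(1) \<delta>pos s by simp
  have L1: "L \<ge> 1"
    using y1 by (simp add: L_def le_nat_floor)
  have Ly: "real L \<le> y" "y \<le> 2 * real L"
    using y1 L1 unfolding L_def by linarith+
  have ys: "y ^ s = 1 / \<delta>"
  proof -
    have "y ^ s = y powr real s"
      using y1 by (simp add: powr_realpow)
    also have "\<dots> = \<delta> powr (- 1)"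
      unfolding y_def using s by (simp add: powr_powr)
    finally show ?thesis
      using \<delta>pos by (simp add: powr_minus_divide)
  qed
  have Ls: "real L ^ s * \<delta> \<le> 1"
  proof -
    have "real L ^ s \<le> 1 / \<delta>"
      unfolding ys[symmetric] using Ly(1) by (intro power_mono) auto
    then show ?thesis
      using \<delta>pos by (simp add: field_simps)
  qed
  have Lsx: "real L ^ s \<le> x"
  proof -
    have "real L ^ s \<le> y ^ s"
      using Ly(1) by (intro power_mono) auto
    also have "\<dots> \<le> x"
      unfolding ys using \<delta>(2) \<delta>pos x4 by (simp add: field_simps)
    finally show ?thesis .
  qed
  have L2x: "(real L)\<^sup>2 \<le> x"
  proof -
    have "(real L)\<^sup>2 \<le> real L ^ s"
      using L1 s by (intro power_increasing) auto
    then show ?thesis using Lsx by linarith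
  qed
  have Lx: "real L \<le> x"
  proof -
    have "real L \<le> (real L)\<^sup>2"
      using L1 by (intro self_le_power) auto
    then show ?thesis
      using L2x by linarith
  qed
  have Xx: "real X \<le> x"
    using x4 by (simp add: X_def)
  have s_split: "Suc d * d div 2 = s + (d - 1)" "d * (d - 1) div 2 = s - 1"
    using triangular_eq_s0[of d] d by (auto simp: s_def s0_Suc)
  \<comment> \<open>The threshold on \<open>x\<close> enters here: together with
    \<open>L\<^sup>2 \<le> L ^ s \<le> x\<close> it absorbs the constant
    \<open>2 * Suc d\<close>.\<close>
  have twokL: "2 * real (Suc d) * real L \<le> x"
  proof (rule power2_le_imp_le)
    have "(2 * real (Suc d) * real L)\<^sup>2 = (2 * real (Suc d))\<^sup>2 * (real L)\<^sup>2"
      by (simp only: power_mult_distrib)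
    also have "\<dots> \<le> x * x"
      using x L2x x4 by (intro mult_mono) auto
    finally show "(2 * real (Suc d) * real L)\<^sup>2 \<le> x\<^sup>2"
      by (simp only: power2_eq_square)
  qed (use x4 in auto)
  have small: "2 * real (Suc d * z * Wmax) \<le> real_of_int q"
  proof -
    have d2: "d - 1 = Suc (d - 2)" "d = Suc (Suc (d - 2))"
      using d by auto
    \<comment> \<open>The factor \<open>\<delta>\<close> absorbs \<open>L ^ s\<close>. Of the
      remaining \<open>L ^ (d - 1)\<close>, one factor takes up the constant through
      \<open>twokL\<close>; with \<open>X\<close> and the other factors this gives at most
      \<open>z * x ^ d\<close>.\<close>
    have "2 * real (Suc d * z * Wmax) * \<delta>
        = real z * (real X * (2 * real (Suc d) * real L ^ (d - 1))) * (real L ^ s * \<delta>)"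
      unfolding Wmax_def s_split(1) power_add by (simp add: algebra_simps)
    also have "\<dots> \<le> real z * (real X * (2 * real (Suc d) * real L ^ (d - 1))) * 1"
      using Ls by (intro mult_left_mono) auto
    also have "\<dots> \<le> real z * (x * (x * x ^ (d - 2)))"
    proof -
      have "2 * real (Suc d) * real L ^ (d - 1) = (2 * real (Suc d) * real L) * real L ^ (d - 2)"
        by (subst d2(1)) (simp only: power_Suc mult_ac)
      also have "\<dots> \<le> x * x ^ (d - 2)"
        using twokL Lx x4 by (intro mult_mono power_mono) auto
      finally have "2 * real (Suc d) * real L ^ (d - 1) \<le> x * x ^ (d - 2)" .
      from mult_mono[OF Xx this] show ?thesis
        using x4 unfolding mult_1_right by (intro mult_left_mono) auto
    qed
    also have "x * (x * x ^ (d - 2)) = x ^ d"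
      by (subst d2(2)) simp
    also have "real z * x ^ d \<le> real_of_int q * \<delta>"
      using \<delta>(3) by (simp add: mult.commute)
    finally show ?thesis
      using \<delta>pos by (simp only: mult_le_cancel_right_pos)
  qed
  have \<eta>_pos: "\<eta> > 0"
    unfolding \<eta> using \<open>\<epsilon> > 0\<close> by (intro divide_pos_pos mult_pos_pos) (auto intro: add_pos_nonneg)
  have divisors: "card {c. c dvd W} \<le> D" if "W \<in> {1..Wmax}" for W
  proof -
    have "real (card {c. c dvd W}) \<le> C * real W powr \<eta>"
      using that by (intro C(2)) auto
    also have "\<dots> \<le> C * real Wmax powr \<eta>"
      using that \<eta>_pos C(1) by (intro mult_left_mono powr_mono2) auto
    finally show ?thesis
      unfolding D_def by (rule le_nat_floor)
  qed
  \<comment> \<open>\<open>Wmax\<close> is at most a fixed power of \<open>x\<close>; dividing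
    \<open>\<epsilon>\<close> by that exponent and by \<open>Suc d\<close> gives
    \<open>\<eta>\<close>, so all \<open>Suc d\<close> divisor factors together cost
    \<open>C ^ Suc d * x powr \<epsilon>\<close>.\<close>
  have D: "real D ^ Suc d \<le> C ^ Suc d * x powr \<epsilon>"
  proof -
    have "real Wmax \<le> x * x ^ (Suc d * d div 2)"
      unfolding Wmax_def of_nat_mult of_nat_power using Xx Lx x4 by (intro mult_mono power_mono) auto
    also have "\<dots> \<le> x * x ^ (Suc d * d)"
      using x4 by (intro mult_left_mono power_increasing) auto
    also have "\<dots> = x powr (1 + real (Suc d * d))"
      using x4 by (simp add: powr_add powr_realpow del: of_nat_mult mult_Suc)
    finally have "real Wmax powr \<eta> \<le> (x powr (1 + real (Suc d * d))) powr \<eta>"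
      using \<eta>_pos by (intro powr_mono2) auto
    also have "\<dots> = x powr (\<epsilon> / real (Suc d))"
    proof -
      have "1 + real (Suc d * d) > 0"
        by (simp add: add_pos_nonneg)
      then have "(1 + real (Suc d * d)) * \<eta> = \<epsilon> / real (Suc d)"
        unfolding \<eta> by (simp del: of_nat_mult mult_Suc)
      then show ?thesis
        by (simp only: powr_powr)
    qed
    finally have "C * real Wmax powr \<eta> \<le> C * x powr (\<epsilon> / real (Suc d))"
      using C(1) by (intro mult_left_mono) auto
    moreover have "real D \<le> C * real Wmax powr \<eta>"
      unfolding D_def using C(1) by simp
    ultimately have "real D ^ Suc d \<le> (C * x powr (\<epsilon> / real (Suc d))) ^ Suc d"
      by (intro power_mono) auto
    also have "\<dots> = C ^ Suc d * (x powr (\<epsilon> / real (Suc d))) ^ Suc d"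
      by (rule power_mult_distrib)
    also have "(x powr (\<epsilon> / real (Suc d))) ^ Suc d = x powr \<epsilon>"
      using x4 by (subst powr_realpow[symmetric]) (simp_all add: powr_powr del: of_nat_Suc power_Suc)
    finally show ?thesis .
  qed
  have oneL: "1 \<le> x / real L"
    using Lx L1 by simp
  have blocks: "4 * real_of_int q * (real (Suc d) * real L ^ (d * (d - 1) div 2) / real (2 * N)) + 1
      \<le> (4 * real (Suc d) + 1) * (x / real L)"
  proof -
    \<comment> \<open>Combines \<open>q \<le> \<delta> * (T * x)\<close> with
      \<open>L ^ s * \<delta> \<le> 1\<close>; the missing power of \<open>L\<close> becomes the
      denominator.\<close>
    have "real_of_int q * real L ^ (s - 1) / real (2 * N) \<le> x / real L"
    proof -
      have "real_of_int q * real L ^ (s - 1) / real (2 * N) \<le> real_of_int q * real L ^ (s - 1) / T"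
        using N q(1) by (intro divide_left_mono) auto
      also have "\<dots> \<le> (\<delta> * (T * x)) * real L ^ (s - 1) / T"
        using \<delta>(4) N by (intro divide_right_mono mult_right_mono) auto
      also have "\<dots> = \<delta> * x * real L ^ (s - 1)"
        using N by simp
      also have "\<dots> = (real L ^ s * \<delta>) * x / real L"
        using L1 s by (cases s) (auto simp: field_simps)
      also have "\<dots> \<le> 1 * x / real L"
        using Ls x4 by (intro divide_right_mono mult_right_mono) auto
      finally show ?thesis by simp
    qed
    then have "4 * real (Suc d) * (real_of_int q * real L ^ (s - 1) / real (2 * N))
        \<le> 4 * real (Suc d) * (x / real L)"
      by (intro mult_left_mono) auto
    then have "4 * real (Suc d) * (real_of_int q * real L ^ (s - 1) / real (2 * N)) + 1
        \<le> 4 * real (Suc d) * (x / real L) + x / real L"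
      using oneL by (rule add_mono)
    also have "4 * real (Suc d) * (real_of_int q * real L ^ (s - 1) / real (2 * N))
        = 4 * real_of_int q * (real (Suc d) * real L ^ (d * (d - 1) div 2) / real (2 * N))"
      unfolding s_split(2) by (simp only: times_divide_eq_right times_divide_eq_left mult_ac)
    also have "4 * real (Suc d) * (x / real L) + x / real L = (4 * real (Suc d) + 1) * (x / real L)"
      by (simp only: distrib_right mult_1)
    finally show ?thesis .
  qed
  let ?R = "x\<^sup>2 / real L"
  have R: "x * (x / real L) = ?R"
    by (simp add: power2_eq_square)
  have xR: "x \<le> ?R"
    using mult_left_mono[OF oneL, of x] x4 unfolding R mult_1_right by simp
  have xe: "x powr \<epsilon> \<ge> 1"
    using x4 \<open>\<epsilon> > 0\<close> by (simp add: ge_one_powr_ge_zero)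
  have "real (card {(m, n) \<in> {1..X} \<times> {1..X}. \<exists>j::int.
          \<bar>real z * poly P (real m) - real z * poly P (real n) - real_of_int j\<bar> \<le> 1 / real (2 * N)})
      \<le> real X + 2 * (real X * ((real X / real L + 1) * real d)
           + real X * real D ^ Suc d
             * (4 * real_of_int q * (real (Suc d) * real L ^ (d * (d - 1) div 2) / real (2 * N)) + 1))"
    using d L1 \<open>z \<ge> 1\<close> \<open>N \<ge> 1\<close> small divisors unfolding Wmax_def
    by (intro card_close_pairs_le[OF deg _ _ _ _ q]) auto
  also have "\<dots> \<le> x + 2 * (x * ((x / real L + x / real L) * real d)
           + x * (C ^ Suc d * x powr \<epsilon>) * ((4 * real (Suc d) + 1) * (x / real L)))"
    using Xx x4 oneL D blocks C(1) q(1)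
    by (intro add_mono mult_mono mult_left_mono divide_right_mono add_nonneg_nonneg mult_nonneg_nonneg) auto
  also have "\<dots> = x + 4 * real d * ?R + 2 * (4 * real (Suc d) + 1) * C ^ Suc d * (?R * x powr \<epsilon>)"
    unfolding R[symmetric] by (simp add: algebra_simps)
  also have "\<dots> \<le> ?R * x powr \<epsilon> + 4 * real d * (?R * x powr \<epsilon>)
      + 2 * (4 * real (Suc d) + 1) * C ^ Suc d * (?R * x powr \<epsilon>)"
  proof -
    have 1: "?R \<le> ?R * x powr \<epsilon>"
      using mult_left_mono[OF xe, of ?R] by (simp only: mult_1_right) simp
    show ?thesis
      by (rule add_right_mono[OF add_mono[OF order_trans[OF xR 1] mult_left_mono[OF 1]]]) simp
  qed
  also have "\<dots> = (1 + 4 * real d + 2 * (4 * real (Suc d) + 1) * C ^ Suc d) * (?R * x powr \<epsilon>)"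
    by (simp only: distrib_right mult_1)
  also have "\<dots> \<le> (1 + 4 * real d + 2 * (4 * real (Suc d) + 1) * C ^ Suc d)
      * (2 * (x\<^sup>2 * x powr \<epsilon> * \<delta> powr (1 / real s)))"
  proof (intro mult_left_mono)
    have "1 / real L \<le> 2 / y"
      using Ly(2) L1 y1 by (simp add: field_simps)
    also have "2 / y = 2 * \<delta> powr (1 / real s)"
      using \<delta>pos by (simp add: y_def powr_minus_divide)
    finally have "x\<^sup>2 * x powr \<epsilon> * (1 / real L) \<le> x\<^sup>2 * x powr \<epsilon> * (2 * \<delta> powr (1 / real s))"
      by (intro mult_left_mono) auto
    then show "?R * x powr \<epsilon> \<le> 2 * (x\<^sup>2 * x powr \<epsilon> * \<delta> powr (1 / real s))"
      by (simp add: mult_ac)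
  qed (use C(1) in auto)
  finally show ?thesis
    by (simp only: mult_ac)
qed

section \<open>Weyl sums and the final estimate\<close>

lemma norm_weyl_sum_le: "x \<ge> 0 \<Longrightarrow> cmod (weyl_sum P x a) \<le> x"
proof -
  assume "x \<ge> 0"
  have "cmod (weyl_sum P x a) \<le> (\<Sum>m\<in>{1..nat \<lfloor>x\<rfloor>}. cmod (e_real (real a * poly P (real m))))"
    unfolding weyl_sum_def by (rule norm_sum)
  also have "\<dots> = real (nat \<lfloor>x\<rfloor>)"
    by simp
  also have "\<dots> \<le> x"
    using \<open>x \<ge> 0\<close> by simp
  finally show ?thesis .
qed

theorem theorem3p1:
  fixes k :: nat and \<epsilon> :: real
  assumes "k \<ge> 3" and "\<epsilon> > 0"
  shows "\<exists>C>0. \<exists>x0>1. \<forall>(P :: real poly) (z :: nat) (x :: real) (T :: real) (u :: int) (q :: int).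
           degree P = k \<and> coeff P 0 = 0 \<and> z \<ge> 1 \<and> x \<ge> x0 \<and> T > 1 \<and>
           q \<ge> 1 \<and> coprime u q \<and>
           \<bar>coeff P k - real_of_int u / real_of_int q\<bar> < 1 / (real_of_int q)\<^sup>2 \<longrightarrow>
           (\<Sum>a\<in>{1..nat \<lfloor>T\<rfloor>}. cmod (weyl_sum P x (a * z)))
             \<le> C * (T * x *
                 (real z * x ^ (k - 1) / real_of_int q
                  + real z * x ^ (k - 1) * ln (real_of_int q) / T
                  + 1 / x
                  + real_of_int q * ln (real_of_int q) / (T * x)) powr (1 / (2 * real (s0 k)))
                 * x powr \<epsilon>)"
proof -
  define d where "d = k - 1"
  have k: "k = Suc d" and d: "d \<ge> 2"
    using assms(1) by (auto simp: d_def)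
  define \<eta> where "\<eta> = \<epsilon> / (real (Suc d) * (1 + real (Suc d * d)))"
  have "\<eta> > 0"
    unfolding \<eta>_def using assms(2) by (intro divide_pos_pos mult_pos_pos) (auto intro: add_pos_nonneg)
  then obtain C where C: "C \<ge> 1" "\<And>n::nat. n > 0 \<Longrightarrow> real (card {d. d dvd n}) \<le> C * real n powr \<eta>"
    using card_divisors_le_powr by blast
  define C2 where "C2 = 2 * (1 + 4 * real d + 2 * (4 * real (Suc d) + 1) * C ^ Suc d)"
  have "C2 \<ge> 1"
  proof -
    have "2 * (4 * real (Suc d) + 1) * C ^ Suc d \<ge> 0"
      using C(1) by (intro mult_nonneg_nonneg) auto
    then show ?thesis
      unfolding C2_def by simp
  qed
  \<comment> \<open>160 comes from the mean square and \<open>C2\<close> from the count of close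
    pairs; the root undoes Cauchy--Schwarz.\<close>
  define K where "K = sqrt (160 * C2)"
  have K: "K \<ge> 1" "K\<^sup>2 = 160 * C2"
    unfolding K_def using \<open>C2 \<ge> 1\<close> by auto
  define x0 where "x0 = (2 * real (Suc d))\<^sup>2"
  have "x0 \<ge> 2\<^sup>2"
    unfolding x0_def by (intro power_mono) auto
  then have x0: "x0 \<ge> 4"
    by simp
  show ?thesis
  proof (rule exI[of _ K], (rule conjI[OF _ exI[of _ x0]]; (intro conjI allI impI)?))
    show "K > 0" "x0 > 1"
      using K(1) x0 by auto
    fix P :: "real poly" and z :: nat and x T :: real and u q :: int
    assume *: "degree P = k \<and> coeff P 0 = 0 \<and> z \<ge> 1 \<and> x \<ge> x0 \<and> T > 1 \<and>
           q \<ge> 1 \<and> coprime u q \<and>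
           \<bar>coeff P k - real_of_int u / real_of_int q\<bar> < 1 / (real_of_int q)\<^sup>2"
    then have q: "q \<ge> 1" "coprime u q"
        "\<bar>coeff P (Suc d) - real_of_int u / real_of_int q\<bar> < 1 / (real_of_int q)\<^sup>2"
      and deg: "degree P = Suc d" and z: "z \<ge> 1" and x: "x \<ge> x0" and T: "T > 1"
      by (auto simp: k)
    have x4: "x \<ge> 4"
      using x x0 by linarith
    define N where "N = nat \<lfloor>T\<rfloor>"
    \<comment> \<open>As \<open>T > 1\<close>, rounding down loses less than a factor 2, so pairs
      within \<open>1 / (2 * N)\<close> are within \<open>1 / T\<close>.\<close>
    have N: "N \<ge> 1" "real N \<le> T" "T \<le> real (2 * N)"
    proof -
      have "\<lfloor>T\<rfloor> \<ge> 1"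
        using T by simp
      moreover from this have "real N = real_of_int \<lfloor>T\<rfloor>"
        by (simp add: N_def)
      ultimately show "N \<ge> 1" "real N \<le> T" "T \<le> real (2 * N)"
        unfolding of_nat_mult by linarith+
    qed
    define \<delta> where "\<delta> = real z * x ^ (k - 1) / real_of_int q
                  + real z * x ^ (k - 1) * ln (real_of_int q) / T
                  + 1 / x
                  + real_of_int q * ln (real_of_int q) / (T * x)"
    let ?s = "real (s0 k)"
    let ?S = "\<Sum>a\<in>{1..N}. cmod (weyl_sum P x (a * z))"
    have ln_q: "ln (real_of_int q) \<ge> 0"
      using q(1) by simp
    have terms: "real z * x ^ (k - 1) / real_of_int q \<ge> 0"
      "real z * x ^ (k - 1) * ln (real_of_int q) / T \<ge> 0"
      "1 / x \<ge> 0" "real_of_int q * ln (real_of_int q) / (T * x) \<ge> 0"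
      using x4 T q(1) ln_q by auto
    have "?S \<le> K * (T * x * \<delta> powr (1 / (2 * ?s)) * x powr \<epsilon>)"
    proof (cases "\<delta> \<ge> 1")
      case True
      \<comment> \<open>For \<open>\<delta> \<ge> 1\<close> the trivial bound suffices.\<close>
      have "?S \<le> (\<Sum>a\<in>{1..N}. x)"
        using x4 by (intro sum_mono norm_weyl_sum_le) auto
      also have "\<dots> \<le> T * x"
        using N x4 by simp
      also have "\<dots> = 1 * (T * x * 1 * 1)"
        by simp
      also have "\<dots> \<le> K * (T * x * \<delta> powr (1 / (2 * ?s)) * x powr \<epsilon>)"
        using K(1) T x4 assms(2) True by (intro mult_mono ge_one_powr_ge_zero) auto
      finally show ?thesis .
    next
      case False
      have \<delta>x: "\<delta> \<ge> 1 / x" "\<delta> \<ge> real z * x ^ d / real_of_int q"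
        "\<delta> \<ge> real_of_int q * ln (real_of_int q) / (T * x)"
        using terms by (auto simp: \<delta>_def d_def)
      have qpos: "real_of_int q > 0"
        using q(1) by simp
      have zq: "real z * x ^ d \<le> \<delta> * real_of_int q"
        using \<delta>x(2) qpos by (simp add: pos_divide_le_eq)
      \<comment> \<open>For \<open>\<delta> < 1\<close> the first term of \<open>\<delta>\<close>
        forces \<open>q \<ge> x \<ge> 4 > exp 1\<close>. Hence \<open>ln q \<ge> 1\<close>, and the
        last term yields \<open>q \<le> \<delta> * (T * x)\<close>.\<close>
      have "x \<le> real_of_int q"
      proof -
        have "x = 1 * x ^ 1"
          by simp
        also have "\<dots> \<le> real z * x ^ d"
          using z x4 d by (intro mult_mono power_increasing) auto
        also have "\<dots> \<le> \<delta> * real_of_int q"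
          by (rule zq)
        also have "\<dots> \<le> 1 * real_of_int q"
          using False qpos by (intro mult_right_mono) auto
        finally show ?thesis by simp
      qed
      then have "exp 1 \<le> real_of_int q"
        using x4 exp_le by linarith
      then have "ln (real_of_int q) \<ge> 1"
        using qpos by (simp add: ln_ge_iff)
      then have "real_of_int q * 1 \<le> real_of_int q * ln (real_of_int q)"
        using qpos by (intro mult_left_mono) auto
      also have "\<dots> \<le> \<delta> * (T * x)"
        using \<delta>x(3) T x4 by (simp add: pos_divide_le_eq)
      finally have qT: "real_of_int q \<le> \<delta> * (T * x)"
        by simp
      have \<delta>pos: "\<delta> > 0"
        using \<delta>x(1) x4 by (smt (verit) divide_pos_pos)
      let ?X = "nat \<lfloor>x\<rfloor>"
      let ?E = "real (card {(m, n) \<in> {1..?X} \<times> {1..?X}. \<exists>j::int.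
             \<bar>real z * poly P (real m) - real z * poly P (real n) - real_of_int j\<bar> \<le> 1 / real (2 * N)})"
      have "?E \<le> C2 * (x\<^sup>2 * x powr \<epsilon> * \<delta> powr (1 / ?s))"
        unfolding C2_def k using x N T False zq qT \<delta>x(1) z assms(2) C
        by (intro card_close_pairs_powr_le[OF deg d _ _ q, where T = T and \<eta> = \<eta>])
           (auto simp: x0_def \<eta>_def)
      moreover have "?S\<^sup>2 \<le> 160 * (real N)\<^sup>2 * ?E"
      proof -
        have "weyl_sum P x (a * z) = (\<Sum>m\<in>{1..?X}. e_real (real a * (real z * poly P (real m))))" for a
          by (simp add: weyl_sum_def mult.assoc)
        then show ?thesis
          using sum_norm_exponential_le[of "{1..?X}" N "\<lambda>m. real z * poly P (real m)"] N(1) by simp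
      qed
      moreover have "160 * (real N)\<^sup>2 * ?E \<le> 160 * T\<^sup>2 * ?E"
        using N by (intro mult_right_mono mult_left_mono power_mono) auto
      ultimately have "?S\<^sup>2 \<le> 160 * T\<^sup>2 * (C2 * (x\<^sup>2 * x powr \<epsilon> * \<delta> powr (1 / ?s)))"
        by (smt (verit) mult_left_mono zero_le_power2)
      also have "\<dots> = (K * (T * x * \<delta> powr (1 / (2 * ?s)) * x powr (\<epsilon> / 2)))\<^sup>2"
      proof -
        have "(y powr (c / 2))\<^sup>2 = y powr c" if "y > 0" for y c :: real
          using that by (simp add: powr_realpow[symmetric] powr_powr)
        from this[of x \<epsilon>] this[of \<delta> "1 / ?s"]
        show ?thesis
          using x4 \<delta>pos by (simp add: power_mult_distrib K(2) mult_ac)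
      qed
      finally have sq: "?S\<^sup>2 \<le> (K * (T * x * \<delta> powr (1 / (2 * ?s)) * x powr (\<epsilon> / 2)))\<^sup>2" .
      have "0 \<le> K * (T * x * \<delta> powr (1 / (2 * ?s)) * x powr (\<epsilon> / 2))"
        using K(1) T x4 by (intro mult_nonneg_nonneg) auto
      with sq have "?S \<le> K * (T * x * \<delta> powr (1 / (2 * ?s)) * x powr (\<epsilon> / 2))"
        by (rule power2_le_imp_le)
      also have "\<dots> \<le> K * (T * x * \<delta> powr (1 / (2 * ?s)) * x powr \<epsilon>)"
        using K(1) T x4 assms(2) by (intro mult_left_mono powr_mono) auto
      finally show ?thesis .
    qed
    then show "(\<Sum>a\<in>{1..nat \<lfloor>T\<rfloor>}. cmod (weyl_sum P x (a * z)))
             \<le> K * (T * x *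
                 (real z * x ^ (k - 1) / real_of_int q
                  + real z * x ^ (k - 1) * ln (real_of_int q) / T
                  + 1 / x
                  + real_of_int q * ln (real_of_int q) / (T * x)) powr (1 / (2 * real (s0 k)))
                 * x powr \<epsilon>)"
      by (simp only: \<delta>_def N_def)
  qed
qed

end
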